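(* Let $q$ be a fixed power of an odd prime and $\gamma$ a fixed generator of $\mathbb{F}_q^\times$. For every $\varepsilon>0$, as $g\to\infty$: (1) $\sum_{P\in\mathcal{P}_{2g+1}}L(2,\chi_P)=\zeta_A(4)\frac{|P|}{\log_q|P|}+O(|P|^{\frac12+\varepsilon})$ with $|P|=q^{2g+1}$; (2) $\sum_{P\in\mathcal{P}_{2g+2}}L(2,\chi_P)=\zeta_A(4)\frac{|P|}{\log_q|P|}+O(|P|^{\frac12+\varepsilon})$ with $|P|=q^{2g+2}$; (3) $\sum_{P\in\mathcal{P}_{2g+2}}L(2,\chi_{\gamma P})=\zeta_A(4)\frac{|P|}{\log_q|P|}+O(|P|^{\frac12+\varepsilon})$ with $|P|=q^{2g+2}$.
   Context: $A=\mathbb{F}_q[T]$ with $q$ odd. For nonzero $f\in A$, $|f|=q^{\deg f}$. $\mathcal{P}_n$ is the set of monic irreducible polynomials of degree $n$. For nonzero square-free $D\in A$, $\chi_D(f)=\left(\frac{D}{f}\right)$ is the Kronecker (Jacobi) symbol for monic $f$, and $L(s,\chi_D)=\sum_{f\text{ monic}}\chi_D(f)|f|^{-s}$ (a polynomial in $q^{-s}$). $\zeta_A(s)=\frac{1}{1-q^{1-s}}$. Implied constants may depend on $q$ and $\varepsilon$. *)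

theory Defs
  imports
    "HOL-Analysis.Analysis"
    "HOL-Library.Landau_Symbols"
    "HOL-Computational_Algebra.Computational_Algebra"
    "HOL-Number_Theory.Cong"
begin

text \<open>
  The field with \<open>q\<close> elements is a type \<open>'a :: {field, finite}\<close> with \<open>CARD('a) = q\<close>, and
  \<open>A\<close> is the polynomial ring \<open>'a poly\<close>.
\<close>

definition monic_polys :: "'a::{field,finite} poly set" where
  "monic_polys = {f. lead_coeff f = 1}"

definition monic_irreducibles :: "nat \<Rightarrow> 'a::{field,finite} poly set" where
  "monic_irreducibles n = {P \<in> monic_polys. irreducible P \<and> degree P = n}"

definition poly_abs :: "'a::{field,finite} poly \<Rightarrow> real" where
  "poly_abs f = (if f = 0 then 0 else real CARD('a) ^ degree f)"

text \<open>The quadratic residue symbol of \<open>D\<close> modulo an irreducible \<open>P\<close>.\<close>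

definition poly_legendre :: "'a::{field,finite} poly \<Rightarrow> 'a poly \<Rightarrow> int" where
  "poly_legendre D P =
     (if P dvd D then 0 else if (\<exists>B. [B\<^sup>2 = D] (mod P)) then 1 else -1)"

text \<open>
  The exponent of \<open>P\<close> in \<open>f\<close>, meant for \<open>f \<noteq> 0\<close> and nonconstant \<open>P\<close>. The library constant
  \<open>multiplicity\<close> is defined in the same way, but for polynomials it requires the coefficient type
  to carry normalization and gcd operations, which a bare field does not have.
\<close>

definition poly_mult_exp :: "'a::{field,finite} poly \<Rightarrow> 'a poly \<Rightarrow> nat" where
  "poly_mult_exp P f = Max {n. P ^ n dvd f}"

text \<open>
  The Jacobi symbol, as the product of quadratic residue symbols over the factorization of a
  monic \<open>f\<close> into monic irreducibles; in particular it is \<open>1\<close> at \<open>f = 1\<close>.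
\<close>

definition quad_char :: "'a::{field,finite} poly \<Rightarrow> 'a poly \<Rightarrow> int" where
  "quad_char D f =
     (\<Prod>P | P \<in> monic_polys \<and> irreducible P \<and> P dvd f. poly_legendre D P ^ poly_mult_exp P f)"

text \<open>
  The Dirichlet series; it is absolutely convergent for \<open>Re s > 1\<close>, which is the only region
  where this definition is meant to be used (\<open>infsum\<close> yields \<open>0\<close> for a non-summable family).
\<close>

definition L_fun :: "complex \<Rightarrow> 'a::{field,finite} poly \<Rightarrow> complex" where
  "L_fun s D =
     (\<Sum>\<^sub>\<infinity>f\<in>monic_polys. of_int (quad_char D f) * of_real (poly_abs f) powr (- s))"

definition zeta_A :: "nat \<Rightarrow> complex \<Rightarrow> complex" where
  "zeta_A q s = 1 / (1 - of_nat q powr (1 - s))"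

definition generates_units :: "'a::{field,finite} \<Rightarrow> bool" where
  "generates_units \<gamma> \<longleftrightarrow> \<gamma> \<noteq> 0 \<and> range (\<lambda>k::int. \<gamma> powi k) = UNIV - {0}"

end

(*
  The squares f = l^2 contribute the main term: the symbol is 1 for every P of degree larger
  than deg l, so they give the number of primes times the sum of |l|^-4.  For deg f >= n/2 the
  trivial bound suffices.  For a nonsquare f of degree less than n/2, reciprocity turns the symbol
  into a sign, depending only on deg f, times the residue symbol of f modulo P, and the sum over P
  is bounded by a constant times deg f * q^(n/2) / n.

  This last bound is the Riemann hypothesis for y^2 = f(x).  It is obtained by the method of
  Stepanov in the form of Bombieri: f^((q^n - 1)/2) is congruent to the symbol modulo P, and
  one constructs a nonzero polynomial G of degree about q^n / 2 that is divisible by every P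
  with a prescribed value of the symbol.  High multiplicity of zeros comes from the Frobenius
  map instead of from derivatives, since only powers f^(q^a) occur.
*)
theory Submission
  imports Defs "HOL-Algebra.Algebraic_Closure_Type"
begin

hide_const (open) Module.smult up_ring.monom up_ring.coeff Coset.order Polynomials.lead_coeff Polynomials.degree Divisibility.irreducible Divisibility.prime

section \<open>The Frobenius map\<close>

text \<open>The split n = a + b with a < b, M = q^a and L = q^b governs the estimates. Raising G(x)
  to the power M turns x^L into x^(M L) = x at a root x of a prime of degree n, so the vanishing of
  G, whose degree is about q^n / 2, follows from that of a polynomial of degree about M^2 plus terms
  involving deg f. For G to be nonzero, the squares of its coefficients, together with f, must have
  degree below L, which keeps M well below L; the error is of order L. So b is taken as close to n /
  2 as a < b allows. Cutting the L-series at degree a costs q^(n - a) = q^b, the same order.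

  The auxiliary polynomial gives only upper bounds. Applied to both signs and combined with the
  count of all primes of degree n, it gives the lower bounds too; for this the prime count needs an
  error of order q^(n/2) before division by n.

  Congruences modulo P are read as equations at a root of P in the algebraic closure, and
  reciprocity becomes a change of sign in a product of differences of roots.\<close>

lemma CARD_field_gt_1: "CARD('a::{field,finite}) > 1"
proof -
  have "card {0, 1 :: 'a} \<le> CARD('a)"
    by (intro card_mono) auto
  then show ?thesis by simp
qed

text \<open>Multiplication by \<open>x\<close> permutes \<open>S\<close>, so the product over
  \<open>S\<close> equals itself times \<open>x ^ card S\<close>. The form with a finite closed
  subset serves both the units of \<open>'a\<close> and the nonzero residues inside the
  closure.\<close>

lemma power_card_eq_1:
  fixes S :: "'b::field set"
  assumes "finite S" "0 \<notin> S" "\<And>x y. x \<in> S \<Longrightarrow> y \<in> S \<Longrightarrow> x * y \<in> S" "x \<in> S"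
  shows "x ^ card S = 1"
proof -
  have x: "x \<noteq> 0" using assms by metis
  have inj: "inj_on ((*) x) S" using x by (auto intro: inj_onI)
  have "(*) x ` S = S"
    using assms by (intro endo_inj_surj[OF _ _ inj]) auto
  then have "(\<Prod>y\<in>S. y) = (\<Prod>y\<in>S. x * y)"
    using prod.reindex[OF inj, of "\<lambda>y. y"] by simp
  also have "\<dots> = x ^ card S * (\<Prod>y\<in>S. y)"
    by (simp add: prod.distrib)
  finally show ?thesis
    using assms by (simp add: prod_zero_iff)
qed

lemma power_CARD_eq_same: "(x::'a::{field,finite}) ^ CARD('a) = x"
proof (cases "x = 0")
  case False
  have "x ^ card (UNIV - {0::'a}) = 1"
    using False by (intro power_card_eq_1) auto
  then have "x ^ (CARD('a) - 1) = 1" by (simp add: card_Diff_singleton)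
  then show ?thesis
    using CARD_field_gt_1[where ?'a = 'a] power_minus_mult[of "CARD('a)" x] by simp
next
  case True
  have "CARD('a) > 0" by simp
  with True show ?thesis by (simp del: zero_less_card_finite)
qed

(* (X + 1)^q - X^q - 1 has degree less than q but vanishes at all q points of the field. *)
lemma of_nat_CARD_choose_eq_0:
  assumes "0 < i" "i < CARD('a::{field,finite})"
  shows "of_nat (CARD('a) choose i) = (0 :: 'a)"
proof -
  define q where "q = CARD('a)"
  have q: "q > 1" unfolding q_def by (rule CARD_field_gt_1)
  have "[:1, 1 :: 'a:] ^ q = monom 1 q + 1"
  proof (rule poly_eqI_degree_lead_coeff)
    have "lead_coeff ([:1, 1 :: 'a:] ^ q) = 1"
      unfolding lead_coeff_power by simp
    moreover have "degree ([:1, 1 :: 'a:] ^ q) = q" by (simp add: degree_linear_power)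
    ultimately show "coeff ([:1, 1 :: 'a:] ^ q) q = coeff (monom 1 q + 1) q"
      using q by simp
    show "card (UNIV :: 'a set) \<ge> q" by (simp add: q_def)
    show "degree ([:1, 1 :: 'a:] ^ q) \<le> q" by (simp add: degree_linear_power)
    show "degree (monom (1::'a) q + 1) \<le> q"
      by (intro degree_add_le) (auto simp: degree_monom_le)
    show "poly ([:1, 1 :: 'a:] ^ q) z = poly (monom 1 q + 1) z" for z
      using power_CARD_eq_same[of z] power_CARD_eq_same[of "1 + z"]
      by (simp add: q_def poly_monom)
  qed
  then have "coeff ([:1, 1 :: 'a:] ^ q) i = 0"
    using assms by (simp add: q_def)
  moreover have "coeff ([:1, 1 :: 'a:] ^ q) i = of_nat (CARD('a) choose i)"
    using coeff_linear_poly_power[of i q 1 1] assms by (simp add: q_def)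
  ultimately show ?thesis by metis
qed

text \<open>The inner binomial coefficients vanish in \<open>'a\<close>, so its characteristic
  divides them and they vanish wherever the characteristic is the same. This carries the Frobenius
  map to \<open>'a poly\<close> and to the closure.\<close>

lemma power_CARD_add:
  fixes x y :: "'b::comm_semiring_1"
  assumes "CHAR('b) = CHAR('a::{field,finite})"
  shows "(x + y) ^ (CARD('a) ^ n) = x ^ (CARD('a) ^ n) + y ^ (CARD('a) ^ n)"
proof (induction n arbitrary: x y)
  case (Suc n)
  define q where "q = CARD('a)"
  have q: "q > 1" unfolding q_def by (rule CARD_field_gt_1)
  have *: "(u + v) ^ q = u ^ q + v ^ q" for u v :: 'b
  proof -
    have "(u + v) ^ q = (\<Sum>k\<le>q. of_nat (q choose k) * u ^ k * v ^ (q - k))"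
      by (rule binomial_ring)
    also have "\<dots> = (\<Sum>k\<in>{0,q}. of_nat (q choose k) * u ^ k * v ^ (q - k))"
    proof (intro sum.mono_neutral_right ballI)
      fix k assume "k \<in> {..q} - {0, q}"
      then have "of_nat (q choose k) = (0 :: 'a)"
        unfolding q_def by (intro of_nat_CARD_choose_eq_0) auto
      then have "of_nat (q choose k) = (0 :: 'b)"
        by (simp add: of_nat_eq_0_iff_char_dvd assms)
      then show "of_nat (q choose k) * u ^ k * v ^ (q - k) = 0" by simp
    qed auto
    finally show ?thesis using q by (simp add: add_ac)
  qed
  show ?case
    using Suc.IH[of "x ^ q" "y ^ q"] by (simp add: power_mult * flip: q_def)
qed auto

lemma power_CARD_sum:
  fixes f :: "'c \<Rightarrow> 'b::comm_semiring_1"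
  assumes "CHAR('b) = CHAR('a::{field,finite})"
  shows "(\<Sum>i\<in>A. f i) ^ (CARD('a) ^ n) = (\<Sum>i\<in>A. f i ^ (CARD('a) ^ n))"
proof -
  have "(0 :: 'b) ^ (CARD('a) ^ n) = 0"
    by (intro zero_power) simp
  then show ?thesis
    by (induction A rule: infinite_finite_induct) (simp_all add: power_CARD_add[OF assms])
qed

lemma power_CARD_power_eq_same: "(x::'a::{field,finite}) ^ (CARD('a) ^ n) = x"
  by (induction n) (simp_all add: power_CARD_eq_same power_mult)

text \<open>The cardinality, being the binomial coefficient at 1, is zero in the field; if 2 were
  zero, an odd cardinality would be one there.\<close>

lemma two_neq_0_of_odd_CARD:
  assumes "odd (CARD('a::{field,finite}))"
  shows "(2 :: 'a) \<noteq> 0"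
proof
  assume 2: "(2 :: 'a) = 0"
  have "of_nat (CARD('a) choose 1) = (0 :: 'a)"
    by (rule of_nat_CARD_choose_eq_0) (use CARD_field_gt_1[where ?'a = 'a] in auto)
  moreover obtain m where "CARD('a) = 2 * m + 1" using assms by (elim oddE)
  ultimately show False using 2 by simp
qed

section \<open>Evaluation at points of the algebraic closure\<close>

text \<open>Evaluation at a root stands in for reduction modulo an irreducible polynomial.\<close>

definition eval_ac :: "'a::field alg_closure \<Rightarrow> 'a poly \<Rightarrow> 'a alg_closure" where
  "eval_ac x f = poly (map_poly to_ac f) x"

lemma eval_ac_0 [simp]: "eval_ac x 0 = 0"
  by (simp add: eval_ac_def)

lemma eval_ac_pCons [simp]: "eval_ac x (pCons c f) = to_ac c + x * eval_ac x f"
  by (simp add: eval_ac_def map_poly_pCons)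

lemma eval_ac_add [simp]: "eval_ac x (f + g) = eval_ac x f + eval_ac x g"
proof (induction f arbitrary: g)
  case (pCons a f)
  then show ?case by (cases g) (auto simp: algebra_simps)
qed auto

lemma eval_ac_smult [simp]: "eval_ac x (smult c f) = to_ac c * eval_ac x f"
  by (induction f) (auto simp: algebra_simps)

lemma eval_ac_mult [simp]: "eval_ac x (f * g) = eval_ac x f * eval_ac x g"
  by (induction f) (auto simp: algebra_simps)

lemma eval_ac_1 [simp]: "eval_ac x 1 = 1"
  by (simp add: one_pCons)

lemma eval_ac_minus [simp]: "eval_ac x (- f) = - eval_ac x f"
  using eval_ac_smult[of x "-1" f] by simp

lemma eval_ac_diff [simp]: "eval_ac x (f - g) = eval_ac x f - eval_ac x g"
  using eval_ac_add[of x f "- g"] by simp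

lemma eval_ac_power [simp]: "eval_ac x (f ^ n) = eval_ac x f ^ n"
  by (induction n) auto

lemma eval_ac_sum: "eval_ac x (\<Sum>i\<in>A. f i) = (\<Sum>i\<in>A. eval_ac x (f i))"
  by (induction A rule: infinite_finite_induct) auto

lemma eval_ac_prod: "eval_ac x (\<Prod>i\<in>A. f i) = (\<Prod>i\<in>A. eval_ac x (f i))"
  by (induction A rule: infinite_finite_induct) auto

lemma eval_ac_monom [simp]: "eval_ac x (monom c n) = to_ac c * x ^ n"
  by (induction n) (auto simp: monom_Suc monom_0)

text \<open>Frobenius fixes the coefficients, so it can be moved from the value to the
  point.\<close>

lemma eval_ac_power_CARD:
  fixes f :: "'a::{field,finite} poly"
  shows "eval_ac x f ^ (CARD('a) ^ n) = eval_ac (x ^ (CARD('a) ^ n)) f"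
proof (induction f)
  case (pCons c f)
  have "to_ac c ^ (CARD('a) ^ n) = to_ac c"
    by (simp add: power_CARD_power_eq_same flip: to_ac_power)
  then show ?case
    by (simp add: power_CARD_add power_mult_distrib pCons.IH)
qed auto

lemma CHAR_poly_eq: "CHAR('a::field poly) = CHAR('a)"
proof (rule CHAR_eqI)
  show "of_nat CHAR('a) = (0 :: 'a poly)"
    by (simp add: of_nat_poly)
  show "CHAR('a) dvd n" if "of_nat n = (0 :: 'a poly)" for n
    using that by (simp add: of_nat_poly of_nat_eq_0_iff_char_dvd)
qed

text \<open>The same identity inside the polynomial ring. It presents \<open>f ^ L\<close> as a
  polynomial in T^L with constant coefficients, as \<open>stepanov_nonvanishing\<close>
  requires.\<close>

lemma poly_power_CARD:
  fixes f :: "'a::{field,finite} poly"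
  shows "f ^ (CARD('a) ^ n) = pcompose f (monom 1 (CARD('a) ^ n))"
proof (induction f)
  case (pCons c f)
  have "pCons c f = [:c:] + monom 1 1 * f"
    by (simp add: monom_Suc monom_0)
  then have "pCons c f ^ (CARD('a) ^ n) = [:c:] ^ (CARD('a) ^ n) + monom 1 1 ^ (CARD('a) ^ n) * f ^ (CARD('a) ^ n)"
    by (simp only: power_CARD_add[OF CHAR_poly_eq] power_mult_distrib)
  also have "\<dots> = pcompose (pCons c f) (monom 1 (CARD('a) ^ n))"
    by (simp add: pCons.IH pcompose_pCons poly_const_pow power_CARD_power_eq_same monom_power)
  finally show ?case .
qed auto

section \<open>Residue fields inside the algebraic closure\<close>

text \<open>The coefficient set is a parameter so that the construction can be iterated: in
  \<open>stepanov_bound\<close> the coefficients are themselves polynomials of bounded degree.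
  Bounding indices instead of the degree makes the count \<open>card C ^ n\<close> right at
  \<open>n = 0\<close> too.\<close>

definition polys_below :: "nat \<Rightarrow> 'b::zero set \<Rightarrow> 'b poly set" where
  "polys_below n C = {p. (\<forall>i. coeff p i \<in> C) \<and> (\<forall>i\<ge>n. coeff p i = 0)}"

lemma polys_below_Suc:
  assumes "0 \<in> C"
  shows "polys_below (Suc n) C = (\<lambda>(c, p). pCons c p) ` (C \<times> polys_below n C)"
proof (intro equalityI subsetI)
  fix p assume p: "p \<in> polys_below (Suc n) C"
  obtain c r where cr: "p = pCons c r" by (cases p)
  have "coeff r i = coeff p (Suc i)" "c = coeff p 0" for i by (simp_all add: cr)
  with p have "c \<in> C" "r \<in> polys_below n C"
    by (auto simp: polys_below_def)
  then show "p \<in> (\<lambda>(c, p). pCons c p) ` (C \<times> polys_below n C)"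
    using cr by force
qed (use assms in \<open>auto simp: polys_below_def coeff_pCons split: nat.splits\<close>)

lemma finite_card_polys_below:
  assumes "finite C" "0 \<in> C"
  shows "finite (polys_below n C) \<and> card (polys_below n C) = card C ^ n"
proof (induction n)
  case 0
  have "polys_below 0 C = {0}"
    using assms by (auto simp: polys_below_def poly_eq_iff)
  then show ?case by simp
next
  case (Suc n)
  have "inj_on (\<lambda>(c, p). pCons c p) (C \<times> polys_below n C)"
    by (auto intro: inj_onI)
  then show ?case
    using Suc assms by (simp add: polys_below_Suc card_image card_cartesian_product)
qed

lemma polys_below_UNIV_iff: "0 < n \<Longrightarrow> p \<in> polys_below n UNIV \<longleftrightarrow> degree p < n"
  by (cases n) (auto simp: polys_below_def coeff_eq_0 Suc_le_eq less_Suc_eq_le intro!: degree_le)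

lemma card_polys_below_UNIV: "card (polys_below n (UNIV :: 'a::{field,finite} set)) = CARD('a) ^ n"
  by (simp add: finite_card_polys_below)

lemma finite_polys_below_UNIV [simp]: "finite (polys_below n (UNIV :: 'a::{field,finite} set))"
  by (simp add: finite_card_polys_below)

lemma irreducible_degree_pos:
  assumes "irreducible (P :: 'a::field poly)"
  shows "degree P > 0"
  using assms is_unit_iff_degree[of P] irreducible_not_unit[OF assms] by (cases "P = 0") auto

lemma irreducible_has_root:
  assumes "irreducible (P :: 'a::field poly)"
  obtains x where "eval_ac x P = 0"
proof -
  have "degree (map_poly to_ac P) = degree P"
    by (rule degree_map_poly) auto
  then show ?thesis
    using that alg_closed_imp_poly_has_root[of "map_poly to_ac P"] irreducible_degree_pos[OF assms]
    by (auto simp: eval_ac_def)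
qed

text \<open>A nonzero \<open>mu\<close> of least degree vanishing at \<open>x\<close> divides
  everything that vanishes there, in particular \<open>P\<close>; irreducibility makes
  \<open>P\<close> an associate of \<open>mu\<close>.\<close>

lemma eval_ac_eq_0_iff_dvd:
  fixes P :: "'a::field poly"
  assumes P: "irreducible P" and x: "eval_ac x P = 0"
  shows "eval_ac x g = 0 \<longleftrightarrow> P dvd g"
proof
  assume g: "eval_ac x g = 0"
  have P0: "P \<noteq> 0" using P by auto
  define mu where "mu = arg_min degree (\<lambda>h. h \<noteq> 0 \<and> eval_ac x h = 0)"
  have mu: "mu \<noteq> 0 \<and> eval_ac x mu = 0"
    unfolding mu_def using P0 x by (intro arg_min_natI[of "\<lambda>h. h \<noteq> 0 \<and> eval_ac x h = 0" P]) auto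
  have min: "degree mu \<le> degree h" if "h \<noteq> 0" "eval_ac x h = 0" for h
    unfolding mu_def using that by (intro arg_min_nat_le) auto
  have dvd: "mu dvd h" if h: "eval_ac x h = 0" for h
  proof -
    have "h mod mu = h - h div mu * mu" by (simp add: minus_div_mult_eq_mod)
    then have "eval_ac x (h mod mu) = 0" using mu h by simp
    then have "h mod mu = 0"
      using min[of "h mod mu"] degree_mod_less'[of mu h] mu by fastforce
    then show ?thesis by auto
  qed
  obtain u where u: "P = mu * u" using dvd[OF x] by auto
  have "\<not> is_unit mu"
  proof
    assume "is_unit mu"
    then obtain c where "mu = [:c:]"
      using mu is_unit_iff_degree[of mu] by (metis degree_eq_zeroE)
    then show False using mu by simp
  qed
  with P u have "is_unit u" using Factorial_Ring.irreducibleD by blast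
  then show "P dvd g" using dvd[OF g] u by (simp add: mult_unit_dvd_iff)
qed (use x in auto)

text \<open>For a root \<open>x\<close> of an irreducible \<open>P\<close> and
  \<open>m = degree P\<close> this is the residue field modulo \<open>P\<close>, embedded in the
  closure.\<close>

definition residues_at :: "'a::{field,finite} alg_closure \<Rightarrow> nat \<Rightarrow> 'a alg_closure set" where
  "residues_at x m = eval_ac x ` polys_below m UNIV"

lemma eval_ac_mod:
  assumes "eval_ac x P = 0"
  shows "eval_ac x (g mod P) = eval_ac x (g :: 'a::field poly)"
proof -
  have "eval_ac x g = eval_ac x (g div P * P + g mod P)" by simp
  also have "\<dots> = eval_ac x (g mod P)" using assms by (simp only: eval_ac_add eval_ac_mult) simp
  finally show ?thesis ..
qed

context
  fixes P :: "'a::{field,finite} poly" and x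
  assumes P: "irreducible P" and x: "eval_ac x P = 0"
begin

lemma finite_residues_at [simp]: "finite (residues_at x m)"
  unfolding residues_at_def by simp

lemma card_residues_at: "card (residues_at x (degree P)) = CARD('a) ^ degree P"
proof -
  have "inj_on (eval_ac x) (polys_below (degree P) UNIV)"
  proof (rule inj_onI)
    fix g h assume gh: "g \<in> polys_below (degree P) UNIV" "h \<in> polys_below (degree P) UNIV"
      and "eval_ac x g = eval_ac x h"
    then have "P dvd g - h" using eval_ac_eq_0_iff_dvd[OF P x, of "g - h"] by simp
    moreover have "degree (g - h) < degree P"
      using gh irreducible_degree_pos[OF P] degree_diff_le_max[of g h]
      by (auto simp: polys_below_UNIV_iff intro: le_less_trans)
    ultimately show "g = h" by (metis dvd_imp_degree_le linorder_not_less right_minus_eq)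
  qed
  then show ?thesis
    by (simp add: residues_at_def card_image card_polys_below_UNIV)
qed

lemma eval_ac_in_residues_at: "eval_ac x g \<in> residues_at x (degree P)"
proof -
  have "degree (g mod P) < degree P \<or> g mod P = 0"
    using degree_mod_less'[of P g] P by (metis not_irreducible_zero)
  then have "g mod P \<in> polys_below (degree P) UNIV"
    using irreducible_degree_pos[OF P] by (auto simp: polys_below_UNIV_iff)
  then show ?thesis
    unfolding residues_at_def by (metis eval_ac_mod[OF x] imageI)
qed

text \<open>Fermat's theorem in the residue field, by \<open>power_card_eq_1\<close> for its nonzero
  elements.\<close>

lemma eval_ac_power_CARD_degree: "eval_ac x g ^ (CARD('a) ^ degree P) = eval_ac x g"
proof (cases "eval_ac x g = 0")
  case False
  have pos: "CARD('a) ^ degree P > 0" by simp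
  have "eval_ac x g ^ card (residues_at x (degree P) - {0}) = 1"
  proof (rule power_card_eq_1)
    fix y z assume yz: "y \<in> residues_at x (degree P) - {0}" "z \<in> residues_at x (degree P) - {0}"
    then obtain a b where "y = eval_ac x a" "z = eval_ac x b"
      by (auto simp: residues_at_def)
    then have "y * z = eval_ac x (a * b)" by simp
    then have "y * z \<in> residues_at x (degree P)" using eval_ac_in_residues_at by metis
    then show "y * z \<in> residues_at x (degree P) - {0}" using yz by auto
  qed (use False eval_ac_in_residues_at in auto)
  also have "card (residues_at x (degree P) - {0}) = CARD('a) ^ degree P - 1"
    using eval_ac_in_residues_at[of 0] by (simp add: card_residues_at card_Diff_singleton)
  finally show ?thesis
    using power_minus_mult[OF pos, of "eval_ac x g"] by simp
qed (simp add: power_0_left)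

end

text \<open>For positive \<open>n\<close> this is the subfield of the closure with q^n
  elements.\<close>

definition frob_fixed :: "nat \<Rightarrow> 'a::{field,finite} alg_closure set" where
  "frob_fixed n = {x. x ^ (CARD('a) ^ n) = x}"

lemma CARD_power_gt_1: "n > 0 \<Longrightarrow> CARD('a::{field,finite}) ^ n > 1"
  using CARD_field_gt_1[where ?'a = 'a] one_less_power by blast

text \<open>The polynomial \<open>p\<close> splits over the closure, and its derivative is the
  constant -1, so it has no repeated root and its number of roots is its degree.\<close>

lemma card_frob_fixed:
  assumes "n > 0"
  shows "finite (frob_fixed n :: 'a::{field,finite} alg_closure set)"
    and "card (frob_fixed n :: 'a alg_closure set) = CARD('a) ^ n"
proof -
  define Q where "Q = CARD('a) ^ n"
  have Q: "Q > 1" unfolding Q_def by (rule CARD_power_gt_1) fact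
  define p :: "'a alg_closure poly" where "p = monom 1 Q - monom 1 1"
  have deg: "degree p = Q" 
    unfolding p_def using Q 
    by (subst diff_conv_add_uminus, subst degree_add_eq_left) (auto simp: degree_monom_eq)
  then have p0: "p \<noteq> 0" using Q by auto
  have roots: "frob_fixed n = {x. poly p x = 0}"
    by (auto simp: frob_fixed_def p_def poly_monom Q_def)
  have "of_nat (CARD('a) choose 1) = (0 :: 'a)"
    by (rule of_nat_CARD_choose_eq_0) (use CARD_field_gt_1[where ?'a = 'a] in auto)
  then have "CHAR('a) dvd CARD('a)"
    by (simp add: of_nat_eq_0_iff_char_dvd)
  then have "of_nat Q = (0 :: 'a alg_closure)"
    using assms by (simp add: of_nat_eq_0_iff_char_dvd Q_def dvd_power_le[of _ _ 1])
  then have pderiv: "pderiv p = - 1"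
    by (simp add: p_def pderiv_diff pderiv_monom monom_0 one_pCons)
  obtain A where A: "size A = degree p" "p = smult (lead_coeff p) (\<Prod>x\<in>#A. [:-x, 1:])"
    using alg_closed_imp_factorization[OF p0] by auto
  have set_A: "set_mset A = {x. poly p x = 0}"
  proof -
    have "poly p x = lead_coeff p * (\<Prod>y\<in>#A. x - y)" for x
      by (subst A(2)) (simp add: poly_prod_mset image_mset.compositionality o_def)
    then show ?thesis using p0 by (auto simp: prod_mset_zero_iff)
  qed
  have "count A a \<le> 1" for a
  proof (rule ccontr)
    assume "\<not> count A a \<le> 1"
    then have "replicate_mset 2 a \<subseteq># A"
      by (simp flip: count_le_replicate_mset_subset_eq)
    then obtain B where "A = replicate_mset 2 a + B" by (metis subset_mset.le_iff_add)
    then have "[:-a, 1:] ^ 2 dvd p"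
      by (subst A(2)) (simp add: dvd_smult del: power2_eq_square)
    then obtain r where r: "p = [:-a, 1:] ^ 2 * r" by (elim dvdE)
    have "poly (pderiv p) a = 0"
      unfolding r by (simp add: pderiv_mult power2_eq_square del: mult_pCons_left mult_pCons_right)
    then show False by (simp add: pderiv)
  qed
  moreover have "count A a = 1" if "a \<in># A" for a
    using calculation[of a] that by (metis One_nat_def count_greater_zero_iff le_antisym Suc_leI)
  ultimately have "size A = card (set_mset A)"
    by (simp add: size_multiset_overloaded_eq)
  then show "card (frob_fixed n :: 'a alg_closure set) = CARD('a) ^ n"
    using A deg set_A roots Q_def by simp
  show "finite (frob_fixed n :: 'a alg_closure set)"
    unfolding roots using p0 by (rule poly_roots_finite)
qed

lemma power_CARD_power_mult:
  assumes "(x :: 'b::monoid_mult) ^ (q ^ m) = x"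
  shows "x ^ (q ^ (m * u)) = x"
  by (induction u) (simp_all add: power_add power_mult assms)

text \<open>If the n-th power of Frobenius fixes \<open>x\<close>, it fixes the whole residue field,
  and so does the power with exponent \<open>r = n mod m\<close>. For \<open>r\<close> nonzero that
  power has only q^r fixed points, fewer than the q^m residues.\<close>

lemma root_in_frob_fixed_iff:
  fixes P :: "'a::{field,finite} poly"
  assumes P: "irreducible P" and x: "eval_ac x P = 0"
  shows "x \<in> frob_fixed n \<longleftrightarrow> degree P dvd n"
proof
  define m where "m = degree P"
  assume "x \<in> frob_fixed n"
  then have xn: "x ^ (CARD('a) ^ n) = x" by (simp add: frob_fixed_def)
  define r u where "r = n mod m" and "u = n div m"
  have n: "n = m * u + r" by (simp add: r_def u_def)
  have sub: "residues_at x m \<subseteq> frob_fixed r"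
  proof
    fix y assume "y \<in> residues_at x m"
    then obtain g where g: "y = eval_ac x g" by (auto simp: residues_at_def)
    have "y ^ (CARD('a) ^ n) = y"
      unfolding g by (simp add: eval_ac_power_CARD xn)
    moreover have "y ^ (CARD('a) ^ m) = y"
      unfolding g m_def by (rule eval_ac_power_CARD_degree[OF P x])
    then have "y ^ (CARD('a) ^ (m * u)) = y" by (rule power_CARD_power_mult)
    ultimately show "y \<in> frob_fixed r"
      by (simp add: frob_fixed_def n power_add power_mult)
  qed
  have "r = 0"
  proof (rule ccontr)
    assume r: "r \<noteq> 0"
    then have "CARD('a) ^ m \<le> CARD('a) ^ r"
      using card_mono[OF card_frob_fixed(1) sub] card_residues_at[OF P x]
      by (simp add: card_frob_fixed m_def)
    then have "m \<le> r"
      using CARD_field_gt_1[where ?'a = 'a] by simp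
    moreover have "r < m" unfolding r_def m_def
      using irreducible_degree_pos[OF P] by simp
    ultimately show False by simp
  qed
  then show "degree P dvd n" by (simp add: r_def m_def mod_eq_0_iff_dvd)
next
  assume "degree P dvd n"
  moreover have "x ^ (CARD('a) ^ degree P) = x"
    using eval_ac_power_CARD_degree[OF P x, of "monom 1 1"] by simp
  ultimately show "x \<in> frob_fixed n"
    by (auto simp: frob_fixed_def intro: power_CARD_power_mult)
qed

section \<open>Conjugate roots of an irreducible polynomial\<close>

lemma eval_ac_power_root:
  fixes P :: "'a::{field,finite} poly"
  assumes "eval_ac x P = 0"
  shows "eval_ac (x ^ (CARD('a) ^ i)) P = 0"
proof -
  have "CARD('a) ^ i > 0" by simp
  then show ?thesis
    using assms eval_ac_power_CARD[of x P i] by (simp add: power_0_left)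
qed

text \<open>A coincidence at \<open>i < j\<close> would put a conjugate, itself a root of
  \<open>P\<close>, into \<open>frob_fixed (j - i)\<close>, although \<open>degree P\<close> cannot
  divide the smaller positive number \<open>j - i\<close>.\<close>

lemma inj_on_conjugates:
  fixes P :: "'a::{field,finite} poly"
  assumes P: "irreducible P" and x: "eval_ac x P = 0"
  shows "inj_on (\<lambda>i. x ^ (CARD('a) ^ i)) {..<degree P}"
proof (rule linorder_inj_onI')
  fix i j assume ij: "i \<in> {..<degree P}" "j \<in> {..<degree P}" "i < j"
  show "x ^ (CARD('a) ^ i) \<noteq> x ^ (CARD('a) ^ j)"
  proof
    assume "x ^ (CARD('a) ^ i) = x ^ (CARD('a) ^ j)"
    moreover have "j = (j - i) + i" using ij by simp
    ultimately have "(x ^ (CARD('a) ^ i)) ^ (CARD('a) ^ (j - i)) = x ^ (CARD('a) ^ i)"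
      by (metis power_add power_mult mult.commute)
    then have "x ^ (CARD('a) ^ i) \<in> frob_fixed (j - i)" by (simp add: frob_fixed_def)
    then have "degree P dvd j - i"
      using root_in_frob_fixed_iff[OF P eval_ac_power_root[OF x]] by simp
    then show False using ij by (auto dest: dvd_imp_le)
  qed
qed

text \<open>Both sides come from monic polynomials of degree \<open>degree P\<close> that agree at
  the \<open>degree P\<close> distinct conjugates. Through this, the norm of one prime modulo
  another becomes a product of differences of roots.\<close>

lemma eval_ac_eq_prod_conjugates:
  fixes P :: "'a::{field,finite} poly"
  assumes P: "irreducible P" and x: "eval_ac x P = 0" and monic: "lead_coeff P = 1"
  shows "eval_ac y P = (\<Prod>i<degree P. y - x ^ (CARD('a) ^ i))"
proof -
  define c where "c = (\<lambda>i. x ^ (CARD('a) ^ i))"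
  define r where "r = (\<Prod>i<degree P. [:- c i, 1:])"
  have deg: "degree r = degree P"
    unfolding r_def by (subst degree_prod_sum_eq) auto
  have lead: "lead_coeff r = 1" 
    unfolding r_def by (simp add: lead_coeff_prod)
  have dm: "degree (map_poly to_ac P) = degree P"
    by (rule degree_map_poly) auto
  have "map_poly to_ac P = r"
  proof (rule poly_eqI_degree_lead_coeff)
    show "coeff (map_poly to_ac P) (degree P) = coeff r (degree P)"
      using monic lead by (simp add: coeff_map_poly deg)
    show "degree P \<le> card (c ` {..<degree P})"
      using inj_on_conjugates[OF P x] by (simp add: card_image c_def)
    fix z assume "z \<in> c ` {..<degree P}"
    then obtain i where i: "i < degree P" "z = c i" by auto
    have "poly r z = 0"
      unfolding r_def using i by (auto simp: poly_prod)
    moreover have "poly (map_poly to_ac P) z = 0"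
      using eval_ac_power_root[OF x, of i] i by (simp add: eval_ac_def c_def)
    ultimately show "poly (map_poly to_ac P) z = poly r z" by simp
  qed (simp_all add: deg dm)
  then show ?thesis
    by (simp add: eval_ac_def r_def poly_prod c_def)
qed

section \<open>Quadratic symbols\<close>

text \<open>Symbols are integers but are computed in the closure. Odd cardinality keeps -1, 0 and 1
  apart there, so identities can be pulled back.\<close>

lemma of_int_sign_inject:
  assumes odd: "odd (CARD('a::{field,finite}))"
    and "a \<in> {-1, 0, 1 :: int}" "b \<in> {-1, 0, 1}"
    and eq: "(of_int a :: 'a alg_closure) = of_int b"
  shows "a = b"
proof -
  have "to_ac 2 \<noteq> (0 :: 'a alg_closure)"
    using two_neq_0_of_odd_CARD[OF odd] by (simp del: to_ac_numeral)
  then have "(1 :: 'a alg_closure) \<noteq> - 1" "(-1 :: 'a alg_closure) \<noteq> 1"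
    by (auto simp: eq_neg_iff_add_eq_0 neg_eq_iff_add_eq_0)
  with assms show ?thesis by auto
qed

lemma poly_legendre_range: "poly_legendre D P \<in> {-1, 0, 1}"
  by (simp add: poly_legendre_def)

text \<open>Recognises residues: in Euler's criterion, a square root in the closure that Frobenius
  fixes must be the value of a polynomial.\<close>

lemma frob_fixed_eq_residues_at:
  fixes P :: "'a::{field,finite} poly"
  assumes P: "irreducible P" and x: "eval_ac x P = 0"
  shows "frob_fixed (degree P) = residues_at x (degree P)"
proof -
  have "residues_at x (degree P) \<subseteq> frob_fixed (degree P)"
    by (auto simp: residues_at_def frob_fixed_def eval_ac_power_CARD_degree[OF P x])
  then show ?thesis
    using card_frob_fixed[OF irreducible_degree_pos[OF P], where ?'a = 'a] card_residues_at[OF P x]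
    by (intro card_subset_eq[symmetric]) auto
qed

(* Euler's criterion: a square root y of D(x) in the algebraic closure satisfies
   y^(q^deg P) = y exactly if D(x)^((q^deg P - 1) / 2) = 1. *)
lemma of_int_poly_legendre:
  fixes P :: "'a::{field,finite} poly"
  assumes odd: "odd (CARD('a))" and P: "irreducible P" and x: "eval_ac x P = 0"
  shows "of_int (poly_legendre D P) = eval_ac x D ^ ((CARD('a) ^ degree P - 1) div 2)"
proof -
  define Q where "Q = CARD('a) ^ degree P"
  define c where "c = (Q - 1) div 2"
  have "odd Q" using odd by (simp add: Q_def)
  moreover have "Q > 1"
    unfolding Q_def by (rule CARD_power_gt_1) (rule irreducible_degree_pos[OF P])
  ultimately have Q: "Q = Suc (2 * c)" and c: "c > 0"
    unfolding c_def by (auto elim!: oddE)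
  have fixed: "eval_ac x g ^ Q = eval_ac x g" for g
    unfolding Q_def by (rule eval_ac_power_CARD_degree[OF P x])
  have one: "eval_ac x g ^ (2 * c) = 1" if "eval_ac x g \<noteq> 0" for g
    using fixed[of g] that by (simp add: Q)
  consider "P dvd D" | B where "\<not> P dvd D" "[B\<^sup>2 = D] (mod P)"
    | "\<not> P dvd D" "\<nexists>B. [B\<^sup>2 = D] (mod P)" by auto
  then have "of_int (poly_legendre D P) = eval_ac x D ^ c"
  proof cases
    case 1
    then have "eval_ac x D = 0" using eval_ac_eq_0_iff_dvd[OF P x] by simp
    \<comment> \<open>Positivity of \<open>c\<close> matters: the power \<open>0 ^ c\<close> has to
      be 0.\<close>
    with 1 c show ?thesis by (simp add: poly_legendre_def)
  next
    case 2
    then have "P dvd B\<^sup>2 - D" by (simp add: cong_iff_dvd_diff)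
    then have *: "eval_ac x D = eval_ac x B ^ 2"
      using eval_ac_eq_0_iff_dvd[OF P x, of "B\<^sup>2 - D"] by simp
    have "eval_ac x D \<noteq> 0" using eval_ac_eq_0_iff_dvd[OF P x, of D] 2 by simp
    then have "eval_ac x B \<noteq> 0" using * by auto
    then have "eval_ac x D ^ c = 1" using one[of B] by (simp add: * flip: power_mult)
    with 2 show ?thesis by (auto simp: poly_legendre_def)
  next
    case 3
    have D0: "eval_ac x D \<noteq> 0" using eval_ac_eq_0_iff_dvd[OF P x, of D] 3 by simp
    then have "(eval_ac x D ^ c) ^ 2 = 1"
      using one[of D] by (simp add: mult.commute flip: power_mult)
    then have "eval_ac x D ^ c = 1 \<or> eval_ac x D ^ c = -1" by (simp add: power2_eq_1_iff)
    moreover have "eval_ac x D ^ c \<noteq> 1"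
    proof
      assume *: "eval_ac x D ^ c = 1"
      obtain y where y: "y ^ 2 = eval_ac x D" using nth_root_exists[of 2] by auto
      have "y ^ Q = y" using * by (simp add: Q power_mult y)
      then have "y \<in> frob_fixed (degree P)" by (simp add: frob_fixed_def Q_def)
      then obtain B where "y = eval_ac x B"
        using frob_fixed_eq_residues_at[OF P x] by (auto simp: residues_at_def)
      then have "eval_ac x (B\<^sup>2 - D) = 0" using y by simp
      then have "[B\<^sup>2 = D] (mod P)"
        unfolding cong_iff_dvd_diff eval_ac_eq_0_iff_dvd[OF P x] .
      then show False using 3 by auto
    qed
    ultimately show ?thesis using 3 by (simp add: poly_legendre_def)
  qed
  then show ?thesis by (simp add: c_def Q_def)
qed

section \<open>Multiplicativity, norms and reciprocity\<close>

lemma poly_legendre_mult: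
  fixes P :: "'a::{field,finite} poly"
  assumes odd: "odd (CARD('a))" and P: "irreducible P"
  shows "poly_legendre (D * E) P = poly_legendre D P * poly_legendre E P"
proof -
  obtain x where x: "eval_ac x P = 0" using irreducible_has_root[OF P] .
  show ?thesis
    using poly_legendre_range[of "D * E" P] poly_legendre_range[of D P] poly_legendre_range[of E P]
    by (intro of_int_sign_inject[OF odd])
      (auto simp: of_int_poly_legendre[OF odd P x] power_mult_distrib)
qed

lemma poly_legendre_1:
  fixes P :: "'a::{field,finite} poly"
  assumes "irreducible P"
  shows "poly_legendre 1 P = 1"
  using irreducible_not_unit[OF assms] cong_refl[of 1 P]
  by (auto simp: poly_legendre_def intro!: exI[of _ 1])

lemma poly_legendre_power:
  fixes P :: "'a::{field,finite} poly"
  assumes odd: "odd (CARD('a))" and P: "irreducible P"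
  shows "poly_legendre (D ^ n) P = poly_legendre D P ^ n"
  by (induction n) (simp_all add: poly_legendre_1[OF P] poly_legendre_mult[OF odd P])

lemma poly_legendre_prod:
  fixes P :: "'a::{field,finite} poly"
  assumes odd: "odd (CARD('a))" and P: "irreducible P"
  shows "poly_legendre (\<Prod>i\<in>A. f i) P = (\<Prod>i\<in>A. poly_legendre (f i) P)"
  by (induction A rule: infinite_finite_induct)
    (simp_all add: poly_legendre_1[OF P] poly_legendre_mult[OF odd P])

text \<open>Splits the exponent in Euler's criterion: the geometric sum gives the norm to the ground
  field, and \<open>(q - 1) div 2\<close> the quadratic character there.\<close>

lemma half_power_minus_1:
  assumes "odd (q::nat)"
  shows "(q ^ m - 1) div 2 = (\<Sum>i<m. q ^ i) * ((q - 1) div 2)"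
proof -
  obtain k where k: "q = 2 * k + 1" using assms by (elim oddE)
  have "q ^ m = 2 * ((\<Sum>i<m. q ^ i) * k) + 1"
    by (induction m) (simp_all add: k algebra_simps)
  then show ?thesis by (simp add: k)
qed

(* The symbol is the quadratic character of the norm of D(x), that is, of a resultant. *)
lemma of_int_poly_legendre_norm:
  fixes P :: "'a::{field,finite} poly"
  assumes odd: "odd (CARD('a))" and P: "irreducible P" and x: "eval_ac x P = 0"
  shows "of_int (poly_legendre D P) =
    (\<Prod>i<degree P. eval_ac (x ^ (CARD('a) ^ i)) D) ^ ((CARD('a) - 1) div 2)"
  unfolding of_int_poly_legendre[OF assms] half_power_minus_1[OF odd] power_mult power_sum
  by (simp add: eval_ac_power_CARD)

text \<open>Both symbols are the same power of a product of differences of roots, one root from each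
  polynomial; exchanging the polynomials flips the sign of each of the
  \<open>degree P * degree R\<close> factors. The sign is written as a power with exponent
  \<open>degree R\<close> so that it multiplies up over the prime factors of a modulus.\<close>

lemma poly_legendre_reciprocity:
  fixes P R :: "'a::{field,finite} poly"
  assumes odd: "odd (CARD('a))"
    and P: "irreducible P" "lead_coeff P = 1" and R: "irreducible R" "lead_coeff R = 1"
  shows "poly_legendre P R = ((-1) ^ ((CARD('a) - 1) div 2 * degree P)) ^ degree R * poly_legendre R P"
proof -
  obtain x where x: "eval_ac x P = 0" using irreducible_has_root[OF P(1)] .
  obtain y where y: "eval_ac y R = 0" using irreducible_has_root[OF R(1)] .
  define k where "k = (CARD('a) - 1) div 2"
  define c d where "c = (\<lambda>i. x ^ (CARD('a) ^ i))" and "d = (\<lambda>i. y ^ (CARD('a) ^ i))"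
  have 1: "of_int (poly_legendre P R) = (\<Prod>j<degree R. \<Prod>i<degree P. d j - c i) ^ k"
    unfolding of_int_poly_legendre_norm[OF odd R(1) y] eval_ac_eq_prod_conjugates[OF P(1) x P(2)]
    by (simp add: c_def d_def k_def)
  have 2: "of_int (poly_legendre R P) = (\<Prod>i<degree P. \<Prod>j<degree R. c i - d j) ^ k"
    unfolding of_int_poly_legendre_norm[OF odd P(1) x] eval_ac_eq_prod_conjugates[OF R(1) y R(2)]
    by (simp add: c_def d_def k_def)
  have "(\<Prod>j<degree R. \<Prod>i<degree P. d j - c i) = (\<Prod>i<degree P. \<Prod>j<degree R. (-1) * (c i - d j))"
    by (subst prod.swap) simp
  also have "\<dots> = ((-1) ^ degree P) ^ degree R * (\<Prod>i<degree P. \<Prod>j<degree R. c i - d j)"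
    by (simp only: prod.distrib prod_constant card_lessThan) (simp add: mult.commute flip: power_mult)
  finally have "(of_int (poly_legendre P R) :: 'a alg_closure) =
      of_int (((-1) ^ (k * degree P)) ^ degree R * poly_legendre R P)"
    by (simp add: 1 2 power_mult_distrib mult_ac flip: power_mult)
  moreover have "((-1) ^ (k * degree P)) ^ degree R * poly_legendre R P \<in> {-1, 0, 1}"
    using poly_legendre_range[of R P] by (auto simp: minus_one_power_iff simp flip: power_mult)
  ultimately show ?thesis
    unfolding k_def[symmetric] using poly_legendre_range[of P R]
    by (intro of_int_sign_inject[OF odd]) auto
qed

text \<open>The norm of a constant is its power with exponent \<open>degree R\<close>, so \<delta>
  is the quadratic character of \<gamma> in the ground field.\<close>

lemma poly_legendre_const:
  fixes \<gamma> :: "'a::{field,finite}"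
  assumes odd: "odd (CARD('a))" and "\<gamma> \<noteq> 0"
  obtains \<delta> :: int where "\<delta> \<in> {1, -1}"
    "\<And>R :: 'a poly. irreducible R \<Longrightarrow> poly_legendre [:\<gamma>:] R = \<delta> ^ degree R"
proof -
  define k where "k = (CARD('a) - 1) div 2"
  have "CARD('a) = Suc (2 * k)"
    unfolding k_def using odd CARD_field_gt_1[where ?'a = 'a] by (auto elim!: oddE)
  then have "\<gamma> * (\<gamma> ^ k) ^ 2 = \<gamma>"
    using power_CARD_eq_same[of \<gamma>] by (simp add: mult.commute flip: power_mult)
  then have "(\<gamma> ^ k) ^ 2 = 1" using \<open>\<gamma> \<noteq> 0\<close> by simp
  then have "\<gamma> ^ k = 1 \<or> \<gamma> ^ k = -1" by (simp only: power2_eq_1_iff)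
  then obtain \<delta> :: int where \<delta>: "\<delta> \<in> {1, -1}" "\<gamma> ^ k = of_int \<delta>" by force
  have "poly_legendre [:\<gamma>:] R = \<delta> ^ degree R" if R: "irreducible R" for R :: "'a poly"
  proof (rule of_int_sign_inject[OF odd])
    obtain y where y: "eval_ac y R = 0" using irreducible_has_root[OF R] .
    have "of_int (poly_legendre [:\<gamma>:] R) = (to_ac (\<gamma> ^ k)) ^ degree R"
      unfolding of_int_poly_legendre_norm[OF odd R y]
      by (simp add: k_def mult.commute flip: power_mult)
    then show "(of_int (poly_legendre [:\<gamma>:] R) :: 'a alg_closure) = of_int (\<delta> ^ degree R)"
      by (simp add: \<delta>)
    show "\<delta> ^ degree R \<in> {- 1, 0, 1}" using \<delta>(1) by (cases "even (degree R)") auto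
  qed (rule poly_legendre_range)
  then show ?thesis using that \<delta> by blast
qed

section \<open>Factorization of monic polynomials\<close>

lemma monic_irreducible_dvd_imp_eq:
  fixes R S :: "'a::{field,finite} poly"
  assumes "irreducible R" "irreducible S" "lead_coeff R = 1" "lead_coeff S = 1" "S dvd R"
  shows "S = R"
proof -
  obtain u where u: "R = S * u" using assms by (elim dvdE)
  have "is_unit u"
    using Factorial_Ring.irreducibleD[OF assms(1) u] irreducible_not_unit[OF assms(2)] by auto
  then obtain c where "u = [:c:]"
    using is_unit_iff_degree[of u] assms u by (metis degree_eq_zeroE is_unit_polyE)
  then have *: "R = smult c S" using u by simp
  then have "c = 1" using assms(3,4) by (simp split: if_splits)
  then show ?thesis using * by simp
qed

lemma monic_irreducible_dvd_prod_iff: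
  fixes S :: "'a::{field,finite} poly"
  assumes A: "finite A" "\<And>R. R \<in> A \<Longrightarrow> irreducible R \<and> lead_coeff R = 1"
    and S: "irreducible S" "lead_coeff S = 1" and e: "\<And>R. R \<in> A \<Longrightarrow> e R > 0"
  shows "S dvd (\<Prod>R\<in>A. R ^ e R) \<longleftrightarrow> S \<in> A"
proof
  assume "S dvd (\<Prod>R\<in>A. R ^ e R)"
  moreover have prime: "prime_elem S" using S field_poly_irreducible_imp_prime by blast
  ultimately obtain R where R: "R \<in> A" "S dvd R ^ e R"
    using prime_elem_dvd_prod_msetE[OF prime, of "image_mset (\<lambda>R. R ^ e R) (mset_set A)"] A(1)
    by (auto simp: prod_unfold_prod_mset)
  then have "S dvd R" using prime prime_elem_dvd_power by blast
  then show "S \<in> A" using monic_irreducible_dvd_imp_eq[of R S] A R S by auto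
next
  assume "S \<in> A"
  then have "S dvd S ^ e S" "S ^ e S dvd (\<Prod>R\<in>A. R ^ e R)"
    using A e by (auto intro: dvd_power)
  then show "S dvd (\<Prod>R\<in>A. R ^ e R)" by (rule dvd_trans)
qed

lemma poly_mult_exp_prod:
  fixes S :: "'a::{field,finite} poly"
  assumes A: "finite A" "\<And>R. R \<in> A \<Longrightarrow> irreducible R \<and> lead_coeff R = 1"
    and e: "\<And>R. R \<in> A \<Longrightarrow> e R > 0" and S: "S \<in> A"
  shows "poly_mult_exp S (\<Prod>R\<in>A. R ^ e R) = e S"
proof -
  define g where "g = (\<Prod>R\<in>A - {S}. R ^ e R)"
  have f: "(\<Prod>R\<in>A. R ^ e R) = S ^ e S * g"
    unfolding g_def using A S by (simp add: prod.remove)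
  have "\<not> S dvd g"
    unfolding g_def using A S e by (subst monic_irreducible_dvd_prod_iff) auto
  have S0: "S \<noteq> 0" using A(2)[OF S] by auto
  have "n \<le> e S" if "S ^ n dvd S ^ e S * g" for n
  proof (rule ccontr)
    assume "\<not> n \<le> e S"
    then have "S ^ e S * S dvd S ^ n" by (metis le_imp_power_dvd not_less_eq_eq power_Suc2)
    then have "S ^ e S * S dvd S ^ e S * g" using that dvd_trans by blast
    then show False using \<open>\<not> S dvd g\<close> S0 by simp
  qed
  then have "{n. S ^ n dvd S ^ e S * g} = {..e S}"
    by (auto simp: le_imp_power_dvd dvd_mult2)
  then show ?thesis unfolding poly_mult_exp_def f by (auto intro: Max_eqI)
qed

text \<open>Induction on the degree: a nonconstant monic divisor of least degree is irreducible and
  can be split off. Distinct primes with separate exponents match the product in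
  \<open>quad_char\<close>.\<close>

lemma monic_factorization:
  fixes f :: "'a::{field,finite} poly"
  assumes "lead_coeff f = 1"
  obtains A e where "finite A" "\<And>R. R \<in> A \<Longrightarrow> irreducible R \<and> lead_coeff R = 1 \<and> e R > 0"
    "f = (\<Prod>R\<in>A. R ^ e R)"
proof -
  have "\<exists>A e. finite A \<and> (\<forall>R\<in>A. irreducible R \<and> lead_coeff R = 1 \<and> e R > 0) \<and> f = (\<Prod>R\<in>A. R ^ e R)"
    using assms
  proof (induction "degree f" arbitrary: f rule: less_induct)
    case less
    show ?case
    proof (cases "degree f = 0")
      case True
      then obtain c where "f = [:c:]" by (elim degree_eq_zeroE)
      with less.prems have "f = 1" by (simp add: one_pCons)
      then show ?thesis by (intro exI[of _ "{}"]) auto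
    next
      case False
      define R where "R = arg_min degree (\<lambda>h. lead_coeff h = 1 \<and> degree h > 0 \<and> h dvd f)"
      have R: "lead_coeff R = 1 \<and> degree R > 0 \<and> R dvd f"
        unfolding R_def using False less.prems by (intro arg_min_natI[of "\<lambda>h. lead_coeff h = 1 \<and> degree h > 0 \<and> h dvd f" f]) auto
      have min: "degree R \<le> degree h" if "lead_coeff h = 1" "degree h > 0" "h dvd f" for h
        unfolding R_def using that by (intro arg_min_nat_le) auto
      have R0: "R \<noteq> 0" using R by auto
      have "irreducible R"
      proof (rule Factorial_Ring.irreducibleI)
        show "\<not> is_unit R" using R R0 is_unit_iff_degree[of R] by auto
        fix a b assume ab: "R = a * b"
        show "is_unit a \<or> is_unit b"
        proof (rule ccontr)
          assume "\<not> (is_unit a \<or> is_unit b)"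
          then have deg: "degree a > 0" "degree b > 0" and ne: "a \<noteq> 0" "b \<noteq> 0"
            using ab R0 is_unit_iff_degree[of a] is_unit_iff_degree[of b] by auto
          define h where "h = smult (inverse (lead_coeff a)) a"
          have "a dvd f" using R ab by (metis dvd_mult_left)
          then have "h dvd f" using ne by (simp add: h_def smult_dvd)
          then have "degree R \<le> degree h"
            using deg ne by (intro min) (auto simp: h_def)
          then show False using deg ne by (simp add: h_def ab degree_mult_eq)
        qed
      qed (rule R0)
      obtain g where g: "f = R * g" using R by (elim conjE dvdE)
      have g0: "g \<noteq> 0" using g less.prems by auto
      have "lead_coeff g = 1" using less.prems R by (simp add: g lead_coeff_mult)
      moreover have "degree g < degree f" using R R0 g0 by (simp add: g degree_mult_eq)
      ultimately obtain A e where A: "finite A"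
        "\<And>S. S \<in> A \<Longrightarrow> irreducible S \<and> lead_coeff S = 1 \<and> e S > 0" "g = (\<Prod>S\<in>A. S ^ e S)"
        using less.hyps[of g] by auto
      show ?thesis
      proof (cases "R \<in> A")
        case True
        define e' where "e' = e(R := Suc (e R))"
        have "f = R * (R ^ e R * (\<Prod>S\<in>A - {R}. S ^ e S))"
          unfolding g A(3) using A(1) True by (simp add: prod.remove)
        also have "\<dots> = R ^ e' R * (\<Prod>S\<in>A - {R}. S ^ e' S)"
          by (simp add: e'_def mult.assoc)
        also have "\<dots> = (\<Prod>S\<in>A. S ^ e' S)"
          using A(1) True by (simp add: prod.remove)
        finally show ?thesis
          using A by (intro exI[of _ A] exI[of _ e']) (auto simp: e'_def)
      next
        case False
        define e' where "e' = e(R := 1)"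
        have "(\<Prod>S\<in>A. S ^ e S) = (\<Prod>S\<in>A. S ^ e' S)"
          using False by (intro prod.cong) (auto simp: e'_def)
        then have "f = (\<Prod>S\<in>insert R A. S ^ e' S)"
          unfolding g A(3) using A(1) False by (simp add: e'_def)
        then show ?thesis
          using A R \<open>irreducible R\<close> by (intro exI[of _ "insert R A"] exI[of _ e']) (auto simp: e'_def)
      qed
    qed
  qed
  then show ?thesis using that by blast
qed

section \<open>From the Jacobi symbol to the residue symbol modulo \<open>P\<close>\<close>

lemma quad_char_prod:
  fixes D :: "'a::{field,finite} poly"
  assumes A: "finite A" "\<And>R. R \<in> A \<Longrightarrow> irreducible R \<and> lead_coeff R = 1 \<and> e R > 0"
  shows "quad_char D (\<Prod>R\<in>A. R ^ e R) = (\<Prod>R\<in>A. poly_legendre D R ^ e R)"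
proof -
  have "{P \<in> monic_polys. irreducible P \<and> P dvd (\<Prod>R\<in>A. R ^ e R)} = A"
    using A by (auto simp: monic_polys_def monic_irreducible_dvd_prod_iff)
  then have "{P. P \<in> monic_polys \<and> irreducible P \<and> P dvd (\<Prod>R\<in>A. R ^ e R)} = A" by simp
  then show ?thesis
    unfolding quad_char_def using A by (simp add: poly_mult_exp_prod)
qed

lemma abs_quad_char_le_1: "\<bar>quad_char D f\<bar> \<le> 1"
proof -
  have "\<bar>poly_legendre D P\<bar> \<le> 1" for P
    using poly_legendre_range[of D P] by auto
  then show ?thesis
    unfolding quad_char_def abs_prod power_abs by (intro prod_le_1) (auto intro: power_le_one)
qed

text \<open>Reciprocity at each prime factor of \<open>f\<close> gives the sign
  \<open>\<tau> ^ degree R\<close>, and these multiply to \<open>\<tau> ^ degree f\<close>. The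
  point is that \<tau> depends on \<gamma> and \<open>n\<close> but not on \<open>P\<close>, so for
  fixed \<open>f\<close> the sign leaves the sum over \<open>P\<close>.\<close>

lemma quad_char_smult:
  fixes \<gamma> :: "'a::{field,finite}"
  assumes odd: "odd (CARD('a))" and \<gamma>: "\<gamma> \<noteq> 0"
  obtains \<tau> :: int where "\<tau> \<in> {1, -1}"
    "\<And>P f. P \<in> monic_irreducibles n \<Longrightarrow> f \<in> monic_polys \<Longrightarrow>
      quad_char (smult \<gamma> P) f = \<tau> ^ degree f * poly_legendre f P"
proof -
  obtain \<delta> :: int where \<delta>: "\<delta> \<in> {1, -1}"
    "\<And>R :: 'a poly. irreducible R \<Longrightarrow> poly_legendre [:\<gamma>:] R = \<delta> ^ degree R"
    using poly_legendre_const[OF odd \<gamma>] by blast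
  define \<tau> where "\<tau> = \<delta> * (-1) ^ ((CARD('a) - 1) div 2 * n)"
  have "\<tau> \<in> {1, -1}" using \<delta> by (auto simp: \<tau>_def minus_one_power_iff)
  moreover have "quad_char (smult \<gamma> P) f = \<tau> ^ degree f * poly_legendre f P"
    if P: "P \<in> monic_irreducibles n" and f: "f \<in> monic_polys" for P f
  proof -
    have P': "irreducible P" "lead_coeff P = 1" "degree P = n"
      using P by (auto simp: monic_irreducibles_def monic_polys_def)
    obtain A e where A: "finite A" "\<And>R. R \<in> A \<Longrightarrow> irreducible R \<and> lead_coeff R = 1 \<and> e R > 0"
      and fA: "f = (\<Prod>R\<in>A. R ^ e R)"
      using monic_factorization[of f] f unfolding monic_polys_def by blast
    have leg: "poly_legendre (smult \<gamma> P) R = \<tau> ^ degree R * poly_legendre R P" if "R \<in> A" for R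
    proof -
      have R: "irreducible R" "lead_coeff R = 1" using A that by auto
      have "poly_legendre (smult \<gamma> P) R = poly_legendre ([:\<gamma>:] * P) R" by simp
      also have "\<dots> = \<delta> ^ degree R * poly_legendre P R"
        by (simp only: poly_legendre_mult[OF odd R(1)] \<delta>(2)[OF R(1)])
      also have "\<dots> = \<tau> ^ degree R * poly_legendre R P"
        by (subst poly_legendre_reciprocity[OF odd P'(1,2) R]) (simp add: \<tau>_def P' power_mult_distrib)
      finally show ?thesis .
    qed
    have "quad_char (smult \<gamma> P) f = (\<Prod>R\<in>A. (\<tau> ^ degree R * poly_legendre R P) ^ e R)"
    proof -
      have "quad_char (smult \<gamma> P) f = (\<Prod>R\<in>A. poly_legendre (smult \<gamma> P) R ^ e R)"
        unfolding fA by (rule quad_char_prod) (use A in auto)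
      then show ?thesis by (simp add: leg)
    qed
    also have "\<dots> = (\<Prod>R\<in>A. \<tau> ^ (degree R * e R)) * (\<Prod>R\<in>A. poly_legendre R P ^ e R)"
      by (simp add: power_mult_distrib prod.distrib power_mult)
    also have "(\<Prod>R\<in>A. \<tau> ^ (degree R * e R)) = (\<Prod>R\<in>A. \<tau> ^ degree (R ^ e R))"
    proof (intro prod.cong refl)
      fix R assume "R \<in> A"
      then have "R \<noteq> 0" using A(2)[of R] by auto
      then show "\<tau> ^ (degree R * e R) = \<tau> ^ degree (R ^ e R)"
        by (simp add: degree_power_eq mult.commute)
    qed
    also have "\<dots> * (\<Prod>R\<in>A. poly_legendre R P ^ e R) = \<tau> ^ (\<Sum>R\<in>A. degree (R ^ e R)) * poly_legendre f P"
      unfolding fA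
      by (simp add: poly_legendre_prod[OF odd P'(1)] poly_legendre_power[OF odd P'(1)] power_sum)
    also have "(\<Sum>R\<in>A. degree (R ^ e R)) = degree f"
      unfolding fA using A(2) by (subst degree_prod_sum_eq) force+
    finally show ?thesis .
  qed
  ultimately show ?thesis using that by blast
qed

lemma poly_legendre_square:
  fixes P :: "'a::{field,finite} poly"
  assumes P: "irreducible P" and "degree g < degree P" "g \<noteq> 0"
  shows "poly_legendre (g\<^sup>2) P = 1"
proof -
  have "\<not> P dvd g" using assms dvd_imp_degree_le[of P g] by auto
  then have "\<not> P dvd g\<^sup>2"
    using field_poly_irreducible_imp_prime[OF P] prime_elem_dvd_power by blast
  then show ?thesis
    using cong_refl[of "g\<^sup>2" P] unfolding poly_legendre_def by meson
qed

section \<open>Counting monic and irreducible polynomials\<close>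

lemma card_monic_polys_degree:
  "finite {f :: 'a::{field,finite} poly. f \<in> monic_polys \<and> degree f = d} \<and>
    card {f :: 'a::{field,finite} poly. f \<in> monic_polys \<and> degree f = d} = CARD('a) ^ d"
proof -
  have "bij_betw (\<lambda>p. monom 1 d + p) (polys_below d UNIV) {f :: 'a poly. f \<in> monic_polys \<and> degree f = d}"
  proof (rule bij_betwI[where g = "\<lambda>f. f - monom 1 d"])
    show "(\<lambda>p. monom 1 d + p) \<in> polys_below d UNIV \<rightarrow> {f :: 'a poly. f \<in> monic_polys \<and> degree f = d}"
    proof
      fix p :: "'a poly" assume p: "p \<in> polys_below d UNIV"
      have le: "degree (monom 1 d + p) \<le> d"
        by (rule degree_le) (use p in \<open>auto simp: polys_below_def\<close>)
      have 1: "coeff (monom 1 d + p) d = 1" using p by (simp add: polys_below_def)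
      then have "degree (monom 1 d + p) = d" using le le_degree[of "monom 1 d + p" d] by simp
      then show "monom 1 d + p \<in> {f. f \<in> monic_polys \<and> degree f = d}"
        using 1 by (simp add: monic_polys_def)
    qed
    show "(\<lambda>f. f - monom 1 d) \<in> {f :: 'a poly. f \<in> monic_polys \<and> degree f = d} \<rightarrow> polys_below d UNIV"
      by (auto simp: polys_below_def monic_polys_def coeff_eq_0 le_eq_less_or_eq)
  qed auto
  from bij_betw_same_card[OF this] bij_betw_finite[OF this] show ?thesis
    by (simp add: card_polys_below_UNIV)
qed

lemma finite_monic_irreducibles [simp]: "finite (monic_irreducibles n)"
  by (rule finite_subset[OF _ conjunct1[OF card_monic_polys_degree[of n]]])
    (auto simp: monic_irreducibles_def)

lemma prod_monic_irreducibles_dvd: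
  fixes g :: "'a::{field,finite} poly"
  assumes "finite A" "\<And>R. R \<in> A \<Longrightarrow> irreducible R \<and> lead_coeff R = 1 \<and> R dvd g"
  shows "\<Prod>A dvd g"
  using assms
proof (induction A arbitrary: g rule: finite_induct)
  case (insert R A)
  then obtain h where h: "g = R * h" by blast
  have "\<Prod>A dvd h"
  proof (rule insert.IH)
    fix S assume S: "S \<in> A"
    then have "prime_elem S" "S dvd R * h"
      using insert.prems[of S] field_poly_irreducible_imp_prime by (auto simp: h)
    then have "S dvd R \<or> S dvd h" by (simp add: prime_elem_dvd_mult_iff)
    moreover have "\<not> S dvd R"
      using monic_irreducible_dvd_imp_eq[of R S] insert S by auto
    ultimately show "irreducible S \<and> lead_coeff S = 1 \<and> S dvd h" using insert.prems S by auto
  qed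
  then show ?case using insert.hyps by (simp add: h)
qed auto

text \<open>Distinct monic irreducibles are coprime, so their product divides \<open>g\<close>. This
  converts the degree of an auxiliary polynomial into a bound on a number of primes.\<close>

lemma card_monic_irreducible_divisors:
  fixes g :: "'a::{field,finite} poly"
  assumes "A \<subseteq> monic_irreducibles n" "\<And>R. R \<in> A \<Longrightarrow> R dvd g" "g \<noteq> 0"
  shows "n * card A \<le> degree g"
proof -
  have fin: "finite A" using assms(1) finite_monic_irreducibles finite_subset by blast
  have "\<Prod>A dvd g"
    using assms by (intro prod_monic_irreducibles_dvd fin) (auto simp: monic_irreducibles_def monic_polys_def)
  then have "degree (\<Prod>A) \<le> degree g" using assms dvd_imp_degree_le by blast
  moreover have "degree (\<Prod>A) = (\<Sum>R\<in>A. degree R)"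
    using assms by (intro degree_prod_sum_eq[of A "\<lambda>x. x", simplified])
      (auto simp: monic_irreducibles_def)
  moreover have "(\<Sum>R\<in>A. degree R) = (\<Sum>R\<in>A. n)"
    using assms by (intro sum.cong) (auto simp: monic_irreducibles_def)
  ultimately show ?thesis by (simp add: mult.commute)
qed

section \<open>Bounds for the number of primes of a given degree\<close>

lemma degree_frob_poly:
  assumes "n > 0"
  defines "F \<equiv> monom 1 (CARD('a) ^ n) - monom 1 1 :: 'a::{field,finite} poly"
  shows "degree F = CARD('a) ^ n" and "lead_coeff F = 1"
    and "eval_ac x F = 0 \<longleftrightarrow> x \<in> frob_fixed n"
proof -
  have Q: "CARD('a) ^ n > 1" by (rule CARD_power_gt_1) fact
  then show deg: "degree F = CARD('a) ^ n" unfolding F_def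
    by (subst diff_conv_add_uminus, subst degree_add_eq_left) (auto simp: degree_monom_eq)
  show "lead_coeff F = 1" unfolding deg using Q by (simp add: F_def)
  show "eval_ac x F = 0 \<longleftrightarrow> x \<in> frob_fixed n"
    by (simp add: F_def frob_fixed_def)
qed

lemma card_monic_irreducibles_le:
  assumes n: "n > 0"
  shows "n * card (monic_irreducibles n :: 'a::{field,finite} poly set) \<le> CARD('a) ^ n"
proof -
  define F :: "'a poly" where "F = monom 1 (CARD('a) ^ n) - monom 1 1"
  note F = degree_frob_poly[OF n, where ?'a = 'a, folded F_def]
  have "n * card (monic_irreducibles n :: 'a poly set) \<le> degree F"
  proof (rule card_monic_irreducible_divisors)
    fix R :: "'a poly" assume R: "R \<in> monic_irreducibles n"
    then have R': "irreducible R" "degree R = n" by (auto simp: monic_irreducibles_def)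
    then obtain x where x: "eval_ac x R = 0" using irreducible_has_root by blast
    have "x \<in> frob_fixed n" using root_in_frob_fixed_iff[OF R'(1) x] R'(2) by simp
    then show "R dvd F" using eval_ac_eq_0_iff_dvd[OF R'(1) x, of F] F(3)[of x] by blast
  qed (use F(2) in auto)
  then show ?thesis using F by simp
qed

lemma sum_power_le:
  assumes "q \<ge> (2::nat)"
  shows "(\<Sum>m\<in>{1..k}. q ^ m) \<le> 2 * q ^ k"
proof (induction k)
  case (Suc k)
  have "2 * q ^ k \<le> q * q ^ k" using assms by (rule mult_right_mono) simp
  moreover have "(\<Sum>m\<in>{1..Suc k}. q ^ m) = (\<Sum>m\<in>{1..k}. q ^ m) + q * q ^ k" by simp
  ultimately show ?case using Suc unfolding power_Suc by linarith
qed auto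

text \<open>An element of the field with q^n elements is a root of a prime whose degree divides
  \<open>n\<close>. If that degree is not \<open>n\<close>, it is at most \<open>n div 2\<close>,
  and the subfields of those degrees have few elements in total.\<close>

lemma card_monic_irreducibles_ge:
  assumes n: "n > 0"
  shows "CARD('a) ^ n \<le> n * card (monic_irreducibles n :: 'a::{field,finite} poly set) + 2 * CARD('a) ^ (n div 2)"
proof -
  define F :: "'a poly" where "F = monom 1 (CARD('a) ^ n) - monom 1 1"
  note F = degree_frob_poly[OF n, where ?'a = 'a, folded F_def]
  define Z where "Z = (\<lambda>P :: 'a poly. {x. eval_ac x P = 0})"
  have Z: "finite (Z P)" "card (Z P) \<le> degree P" if "P \<noteq> 0" for P
  proof -
    have "degree (map_poly to_ac P) = degree P" by (rule degree_map_poly) auto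
    moreover have "map_poly to_ac P \<noteq> 0" using that by (simp add: map_poly_eq_0_iff)
    ultimately show "finite (Z P)" "card (Z P) \<le> degree P"
      using poly_roots_finite[of "map_poly to_ac P"] card_poly_roots_bound[of "map_poly to_ac P"]
      by (auto simp: Z_def eval_ac_def)
  qed
  have "frob_fixed n \<subseteq> (\<Union>P\<in>monic_irreducibles n. Z P) \<union> (\<Union>m\<in>{1..n div 2}. frob_fixed m)"
  proof
    fix x :: "'a alg_closure" assume x: "x \<in> frob_fixed n"
    \<comment> \<open>The factor of \<open>F\<close> that vanishes at \<open>x\<close> serves as its
      minimal polynomial.\<close>
    obtain A e where A: "finite A" "\<And>R. R \<in> A \<Longrightarrow> irreducible R \<and> lead_coeff R = 1 \<and> e R > (0::nat)"
      "F = (\<Prod>R\<in>A. R ^ e R)" using monic_factorization[OF F(2)] by metis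
    have "(\<Prod>R\<in>A. eval_ac x R ^ e R) = 0"
      using F(3)[of x] x by (simp add: A(3) eval_ac_prod)
    then obtain R where "R \<in> A" and xR: "eval_ac x R = 0" using A(1) by auto
    then have R: "irreducible R" "lead_coeff R = 1" using A by auto
    have dvd: "degree R dvd n" using x root_in_frob_fixed_iff[OF R(1) xR] by simp
    show "x \<in> (\<Union>P\<in>monic_irreducibles n. Z P) \<union> (\<Union>m\<in>{1..n div 2}. frob_fixed m)"
    proof (cases "degree R = n")
      case True
      with R xR show ?thesis by (auto simp: monic_irreducibles_def monic_polys_def Z_def)
    next
      case False
      obtain k where k: "n = degree R * k" using dvd by (elim dvdE)
      with False n have "k \<ge> 2" by (cases k; cases "k - 1") auto
      then have "2 * degree R \<le> n" unfolding k by simp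
      then have "degree R \<in> {1..n div 2}" using irreducible_degree_pos[OF R(1)] by auto
      moreover have "x \<in> frob_fixed (degree R)" using root_in_frob_fixed_iff[OF R(1) xR] by simp
      ultimately show ?thesis by blast
    qed
  qed
  moreover have fin1: "finite (\<Union>P\<in>monic_irreducibles n. Z P)"
  proof (rule finite_UN_I)
    fix P :: "'a poly" assume "P \<in> monic_irreducibles n"
    then have "P \<noteq> 0" by (auto simp: monic_irreducibles_def)
    then show "finite (Z P)" by (rule Z(1))
  qed simp
  moreover have fin2: "finite (\<Union>m\<in>{1..n div 2}. frob_fixed m :: 'a alg_closure set)"
    by (auto intro!: card_frob_fixed)
  ultimately have "card (frob_fixed n :: 'a alg_closure set) \<le> card (\<Union>P\<in>monic_irreducibles n. Z P)
      + card (\<Union>m\<in>{1..n div 2}. frob_fixed m :: 'a alg_closure set)"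
    by (meson card_Un_le card_mono finite_UnI le_trans)
  also have "card (\<Union>P\<in>monic_irreducibles n. Z P) \<le> (\<Sum>P\<in>(monic_irreducibles n :: 'a poly set). card (Z P))"
    by (intro card_UN_le) simp
  also have "\<dots> \<le> (\<Sum>P\<in>(monic_irreducibles n :: 'a poly set). n)"
  proof (intro sum_mono)
    fix P :: "'a poly" assume P: "P \<in> monic_irreducibles n"
    then have "P \<noteq> 0" by (auto simp: monic_irreducibles_def)
    then show "card (Z P) \<le> n" using Z(2)[of P] P by (simp add: monic_irreducibles_def)
  qed
  also have "card (\<Union>m\<in>{1..n div 2}. frob_fixed m :: 'a alg_closure set)
      \<le> (\<Sum>m\<in>{1..n div 2}. card (frob_fixed m :: 'a alg_closure set))"
    by (intro card_UN_le) simp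
  also have "\<dots> = (\<Sum>m\<in>{1..n div 2}. CARD('a) ^ m)"
    by (intro sum.cong) (auto simp: card_frob_fixed)
  also have "\<dots> \<le> 2 * CARD('a) ^ (n div 2)"
    using CARD_field_gt_1[where ?'a = 'a] by (intro sum_power_le) auto
  finally show ?thesis
    using n by (simp add: card_frob_fixed mult.commute)
qed

section \<open>The Stepanov--Bombieri bound\<close>

lemma exists_irreducible_divisor:
  fixes r :: "'a::{field,finite} poly"
  assumes "degree r > 0"
  obtains p where "irreducible p" "p dvd r"
proof -
  define r' where "r' = smult (inverse (lead_coeff r)) r"
  have r0: "r \<noteq> 0" using assms by auto
  then have lead: "lead_coeff r' = 1" by (simp add: r'_def)
  then obtain A e where A: "finite A" "\<And>R. R \<in> A \<Longrightarrow> irreducible R \<and> lead_coeff R = 1 \<and> e R > (0::nat)"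
    "r' = (\<Prod>R\<in>A. R ^ e R)" using monic_factorization by metis
  have "A \<noteq> {}"
  proof
    assume "A = {}"
    then have "degree r' = 0" using A(3) by simp
    then show False using assms r0 by (simp add: r'_def)
  qed
  then obtain R where R: "R \<in> A" by auto
  then have "R dvd R ^ e R" "R ^ e R dvd r'"
    using A by (auto intro: dvd_power)
  then have "R dvd r'" by (rule dvd_trans)
  then have "R dvd r" using r0 by (simp add: r'_def dvd_smult_iff)
  then show ?thesis using that A(2)[OF R] by blast
qed

text \<open>A polynomial that is the square of a rational function is the square of a polynomial: an
  irreducible factor of \<open>r\<close> also divides \<open>t\<close> and cancels, until
  \<open>r\<close> is constant.\<close>

lemma square_quotient_imp_square:
  fixes f r t :: "'a::{field,finite} poly"
  assumes "f * r\<^sup>2 = t\<^sup>2" "r \<noteq> 0"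
  shows "\<exists>g. f = g\<^sup>2"
  using assms
proof (induction "degree r" arbitrary: r t rule: less_induct)
  case less
  show ?case
  proof (cases "degree r = 0")
    case True
    then obtain c where c: "r = [:c:]" by (elim degree_eq_zeroE)
    with less.prems have c0: "c \<noteq> 0" by simp
    have "(smult (inverse c) t)\<^sup>2 = smult ((inverse c)\<^sup>2) (f * r\<^sup>2)"
      unfolding less.prems(1) by (simp add: smult_power)
    also have "\<dots> = f" using c0 by (simp add: c power2_eq_square field_simps)
    finally show ?thesis by metis
  next
    case False
    then obtain p where p: "irreducible p" "p dvd r" using exists_irreducible_divisor by blast
    then obtain r' where r': "r = p * r'" by (elim dvdE)
    have p0: "p \<noteq> 0" using p by auto
    have r0: "r' \<noteq> 0" using r' less.prems by auto
    have "p dvd t\<^sup>2"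
      unfolding less.prems(1)[symmetric] r' by (simp add: power2_eq_square)
    then have "p dvd t" using field_poly_irreducible_imp_prime[OF p(1)] prime_elem_dvd_power by blast
    then obtain t' where t': "t = p * t'" by (elim dvdE)
    have "p\<^sup>2 * (f * r'\<^sup>2) = p\<^sup>2 * t'\<^sup>2"
      using less.prems(1) by (simp add: r' t' power_mult_distrib mult_ac)
    then have "f * r'\<^sup>2 = t'\<^sup>2" using p0 by simp
    moreover have "degree r' < degree r"
      using r' p0 r0 irreducible_degree_pos[OF p(1)] by (simp add: degree_mult_eq)
    ultimately show ?thesis using less.hyps[of r' t'] r0 by blast
  qed
qed

text \<open>Coefficients of degree below \<open>L\<close> are digits in base T^L, so substituting
  T^L for the outer variable loses nothing.\<close>

lemma poly_monom_eq_0_imp_eq_0: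
  fixes p :: "'a::field poly poly"
  assumes "\<And>i. degree (coeff p i) < L" "poly p (monom 1 L) = 0"
  shows "p = 0"
  using assms
proof (induction p)
  case (pCons c p)
  have deg: "degree c < L" "\<And>i. degree (coeff p i) < L"
    using pCons.prems(1)[of 0] pCons.prems(1)[of "Suc _"] by auto
  have eq: "c = - (monom 1 L * poly p (monom 1 L))"
    using pCons.prems(2) by (simp add: eq_neg_iff_add_eq_0)
  have "poly p (monom 1 L) = 0"
  proof (rule ccontr)
    assume "poly p (monom 1 L) \<noteq> 0"
    then have "degree c \<ge> L" unfolding eq
      by (simp add: degree_mult_eq degree_monom_eq monom_eq_0_iff)
    then show False using deg by simp
  qed
  then show ?case using pCons.IH deg(2) eq by simp
qed auto

lemma degree_coeff_mult_le:
  fixes p r :: "'a::field poly poly"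
  assumes "\<And>i. degree (coeff p i) \<le> a" "\<And>i. degree (coeff r i) \<le> b"
  shows "degree (coeff (p * r) i) \<le> a + b"
  unfolding coeff_mult
  by (intro degree_sum_le) (auto intro!: order.trans[OF degree_mult_le] add_mono assms)

text \<open>Isolating the second term, squaring and multiplying by \<open>f\<close> replaces the
  large power of \<open>f\<close> by \<open>f ^ L\<close>, a polynomial in T^L. The bound
  \<open>small\<close> permits comparing digits in base T^L, and the leading coefficients in the
  outer variable would then make \<open>f\<close> a square of a rational function.\<close>

lemma stepanov_nonvanishing:
  fixes f :: "'a::{field,finite} poly" and R S :: "'a poly poly"
  assumes monic: "lead_coeff f = 1" and nonsquare: "\<nexists>g. f = g\<^sup>2"
    and L: "L = CARD('a) ^ b" and odd: "odd L"
    and R: "\<And>i. degree (coeff R i) \<le> l" and S: "\<And>i. degree (coeff S i) \<le> l"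
    and small: "degree f + 2 * l < L"
    and eq: "poly R (monom 1 L) + f ^ ((L - 1) div 2) * poly S (monom 1 L) = 0"
  shows "R = 0 \<and> S = 0"
proof -
  define h where "h = f ^ ((L - 1) div 2)"
  define T where "T = (monom 1 L :: 'a poly)"
  \<comment> \<open>This is \<open>f\<close> written in the outer variable.\<close>
  define F where "F = map_poly (\<lambda>c. [:c:]) f"
  have F: "poly F T = f ^ L"
    unfolding F_def T_def L by (simp add: poly_power_CARD pcompose_altdef)
  have "2 * ((L - 1) div 2) + 1 = L" using odd by (auto elim!: oddE)
  then have h: "f * h\<^sup>2 = f ^ L"
    unfolding h_def by (metis Suc_eq_plus1 mult.commute power_Suc power_mult)
  have "poly R T = - (h * poly S T)"
    using eq by (simp add: h_def T_def eq_neg_iff_add_eq_0)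
  then have "f * (poly R T)\<^sup>2 = f * h\<^sup>2 * (poly S T)\<^sup>2"
    by (simp add: power_mult_distrib)
  then have "poly (smult f (R\<^sup>2) - F * S\<^sup>2) T = 0"
    by (simp add: F h)
  moreover have "degree (coeff (smult f (R\<^sup>2) - F * S\<^sup>2) i) < L" for i
  proof -
    have R2: "degree (coeff (R\<^sup>2) i) \<le> l + l" for i
      unfolding power2_eq_square by (intro degree_coeff_mult_le R)
    have S2: "degree (coeff (S\<^sup>2) i) \<le> l + l" for i
      unfolding power2_eq_square by (intro degree_coeff_mult_le S)
    have "degree (coeff F i) \<le> 0" for i
      by (simp add: F_def coeff_map_poly)
    then have "degree (coeff (F * S\<^sup>2) i) \<le> 0 + (l + l)"
      by (intro degree_coeff_mult_le S2)
    moreover have "degree (coeff (smult f (R\<^sup>2)) i) \<le> degree f + (l + l)"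
      using R2[of i] degree_mult_le[of f "coeff (R\<^sup>2) i"] by simp
    ultimately have "degree (coeff (smult f (R\<^sup>2) - F * S\<^sup>2) i) \<le> degree f + (l + l)"
      unfolding coeff_diff by (intro degree_diff_le) auto
    then show ?thesis using small by simp
  qed
  ultimately have "smult f (R\<^sup>2) - F * S\<^sup>2 = 0"
    unfolding T_def by (intro poly_monom_eq_0_imp_eq_0[of _ L]) auto
  then have eq': "smult f (R\<^sup>2) = F * S\<^sup>2" by simp
  have leadF: "lead_coeff F = 1"
    unfolding F_def by (subst lead_coeff_map_poly_nz) (use monic in \<open>auto simp: one_pCons\<close>)
  have "lead_coeff (smult f (R\<^sup>2)) = lead_coeff (F * S\<^sup>2)" using eq' by simp
  then have *: "f * (lead_coeff R)\<^sup>2 = (lead_coeff S)\<^sup>2"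
    using leadF by (simp only: lead_coeff_smult lead_coeff_mult lead_coeff_power) simp
  have "R = 0"
  proof (rule ccontr)
    assume "R \<noteq> 0"
    then have "lead_coeff R \<noteq> 0" by simp
    then show False using square_quotient_imp_square[OF *] nonsquare by blast
  qed
  moreover have "F \<noteq> 0" using leadF by auto
  ultimately show ?thesis using eq' by simp
qed

lemma poly_eq_sum_polys_below:
  fixes p :: "'b::comm_semiring_1 poly"
  assumes "p \<in> polys_below J C"
  shows "poly p x = (\<Sum>j<J. coeff p j * x ^ j)"
proof -
  have "poly p x = (\<Sum>j\<le>degree p. coeff p j * x ^ j)" by (rule poly_altdef)
  also have "\<dots> = (\<Sum>j\<in>{..degree p} \<union> {..<J}. coeff p j * x ^ j)"
    by (rule sum.mono_neutral_left) (auto simp: coeff_eq_0)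
  also have "\<dots> = (\<Sum>j<J. coeff p j * x ^ j)"
    by (rule sum.mono_neutral_right) (use assms in \<open>auto simp: polys_below_def\<close>)
  finally show ?thesis .
qed

lemma diff_in_polys_below:
  assumes "\<And>a b. a \<in> C \<Longrightarrow> b \<in> C \<Longrightarrow> a - b \<in> C" "p \<in> polys_below n C" "r \<in> polys_below n C"
  shows "p - r \<in> polys_below n C"
  using assms by (auto simp: polys_below_def)

(* With M L = q^n, the auxiliary polynomial is
   G = R(T^L) + f^((L-1)/2) S(T^L).  At a root x of P we have x^(M L) = x, so that
   f^((M-1)/2) G^M takes the same value as a polynomial of low degree depending additively
   on (R, S), which can be made to vanish identically by counting. *)
lemma stepanov_bound:
  fixes f :: "'a::{field,finite} poly"
  assumes odd: "odd (CARD('a))"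
    and monic: "lead_coeff f = 1" and nonsquare: "\<nexists>g. f = g\<^sup>2"
    and n: "n = a + b" "a < b"
    and d: "0 < degree f" "degree f \<le> CARD('a) ^ a"
    and s: "s \<in> {1, -1}"
  shows "2 * (n * card {P \<in> monic_irreducibles n. poly_legendre f P = s})
    \<le> CARD('a) ^ n + 4 * degree f * CARD('a) ^ b"
proof -
  define M L where "M = CARD('a) ^ a" and "L = CARD('a) ^ b"
  define d where "d = degree f"
  define k where "k = (M - 1) div 2"
  \<comment> \<open>\<open>J\<close> counts the coefficients of \<open>R\<close>, and
    \<open>B\<close> bounds the degree of the values of \<open>Phi\<close>. There are
    \<open>2 * M * J\<close> free parameters in the ground field against \<open>B\<close>
    conditions; the summand \<open>d\<close> of \<open>J\<close> pays for the \<open>d * k\<close>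
    in \<open>B\<close>.\<close>
  define J where "J = k + 1 + d"
  define B where "B = M * M + d * k + J"
  define h where "h = (L - 1) div 2"
  define T where "T = (monom 1 L :: 'a poly)"
  have "odd M" "odd L" using odd by (simp_all add: M_def L_def)
  then have Mk: "M = 2 * k + 1" and Lh: "L = 2 * h + 1"
    unfolding k_def h_def by (auto elim!: oddE)
  have Q_eq: "M * L = CARD('a) ^ n" by (simp add: M_def L_def n power_add)
  have "CARD('a) \<noteq> 2" using odd by auto
  then have q3: "CARD('a) \<ge> 3" using CARD_field_gt_1[where ?'a = 'a] by linarith
  \<comment> \<open>With \<open>d \<le> M\<close> this yields \<open>d + 2 * (M - 1) < L\<close>,
    the condition \<open>small\<close> for nonvanishing.\<close>
  have "3 * M \<le> CARD('a) * CARD('a) ^ a" using q3 by (simp add: M_def)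
  also have "\<dots> = CARD('a) ^ Suc a" by simp
  also have "\<dots> \<le> L" unfolding L_def using n by (intro power_increasing) auto
  finally have M3: "3 * M \<le> L" .
  have dM: "0 < d" "d \<le> M" using d by (auto simp: d_def M_def)
  have Mpos: "0 < M" "0 < J" "0 < B" using Mk by (auto simp: J_def B_def)

  define C where "C = (polys_below M UNIV :: 'a poly set)"
  have C: "c \<in> C \<longleftrightarrow> degree c < M" for c :: "'a poly"
    unfolding C_def using Mpos by (intro polys_below_UNIV_iff)
  define V where "V = polys_below J C"
  have V: "finite V" "card V = (CARD('a) ^ M) ^ J"
    unfolding V_def using finite_card_polys_below[of C J] C[of 0] Mpos
    by (auto simp: C_def card_polys_below_UNIV)
  \<comment> \<open>The low-degree form of the M-th power of R(T^L) at points with x^(M L) = x: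
    coefficients are raised to the power \<open>M\<close>, and the outer variable becomes T
    itself.\<close>
  define star where "star = (\<lambda>R :: 'a poly poly. \<Sum>j<J. coeff R j ^ M * monom 1 1 ^ j)"
  \<comment> \<open>Represents \<open>f ^ k * G ^ M\<close> at the roots in question: as
    \<open>(M * L - 1) div 2 = k + h * M\<close>, Euler's criterion collapses
    \<open>f ^ k * (f ^ h) ^ M\<close> to \<open>s\<close>.\<close>
  define Phi where "Phi = (\<lambda>(R, S). f ^ k * star R + smult (of_int s) (star S))"
  have star_deg: "degree (star R) < M * M + J" if "R \<in> V" for R
  proof -
    have "degree (coeff R j ^ M * monom 1 1 ^ j) \<le> (M - 1) * M + (J - 1)" if "j < J" for j
    proof -
      have "coeff R j \<in> C" using \<open>R \<in> V\<close> by (auto simp: V_def polys_below_def)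
      then have "degree (coeff R j) \<le> M - 1" using C[of "coeff R j"] by linarith
      then have "degree (coeff R j ^ M) \<le> (M - 1) * M"
        by (intro order.trans[OF degree_power_le] mult_right_mono) auto
      moreover have "degree (monom (1::'a) 1 ^ j) \<le> J - 1"
        using that by (simp add: monom_power degree_monom_eq)
      ultimately show ?thesis
        by (intro order.trans[OF degree_mult_le] add_mono)
    qed
    then have "degree (star R) \<le> (M - 1) * M + (J - 1)"
      unfolding star_def by (intro degree_sum_le) auto
    also have "\<dots> < M * M + J"
      using Mpos by (intro add_le_less_mono mult_right_mono) auto
    finally show ?thesis .
  qed
  have "Phi ` (V \<times> V) \<subseteq> polys_below B UNIV"
  proof (clarify)
    fix R S assume RS: "R \<in> V" "S \<in> V"
    have "degree (f ^ k * star R) < B"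
      using degree_mult_le[of "f ^ k" "star R"] degree_power_le[of f k] star_deg[OF RS(1)]
      by (simp add: B_def d_def)
    moreover have "degree (smult (of_int s) (star S)) < B"
      using degree_smult_le[of "of_int s" "star S"] star_deg[OF RS(2)] by (simp add: B_def)
    ultimately have "degree (Phi (R, S)) < B"
      unfolding Phi_def by (auto intro: degree_add_less)
    then show "Phi (R, S) \<in> polys_below B UNIV" using Mpos by (simp add: polys_below_UNIV_iff)
  qed
  then have "card (Phi ` (V \<times> V)) \<le> CARD('a) ^ B"
    using card_mono[of "polys_below B (UNIV :: 'a set)" "Phi ` (V \<times> V)"]
    by (simp add: card_polys_below_UNIV)
  also have "\<dots> < CARD('a) ^ (2 * M * J)"
  proof (intro power_strict_increasing)
    \<comment> \<open>This is the inequality after cancelling \<open>M * M\<close>, since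
      \<open>2 * J = M + 1 + 2 * d\<close>.\<close>
    have "d * k + k + 1 + d < M + 2 * M * d"
      using dM by (simp add: Mk algebra_simps)
    then show "B < 2 * M * J"
      by (simp add: B_def J_def Mk algebra_simps)
  qed (use CARD_field_gt_1 in auto)
  also have "\<dots> = card (V \<times> V)"
    by (simp only: card_cartesian_product V power_mult[symmetric] power_add[symmetric]) (simp add: mult_2 add_mult_distrib)
  finally have "\<not> inj_on Phi (V \<times> V)" by (rule pigeonhole)
  \<comment> \<open>Pigeonhole takes the place of a dimension count: \<open>star\<close> is additive
    because \<open>M\<close> is a power of q, so the difference of a colliding pair lies in the
    kernel of \<open>Phi\<close>.\<close>
  then obtain R1 S1 R2 S2 where RS: "R1 \<in> V" "S1 \<in> V" "R2 \<in> V" "S2 \<in> V"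
    "(R1, S1) \<noteq> (R2, S2)" "Phi (R1, S1) = Phi (R2, S2)"
    unfolding inj_on_def by (auto simp del: split_paired_All)
  define R S where "R = R1 - R2" and "S = S1 - S2"
  have RS_V: "R \<in> V" "S \<in> V"
    unfolding R_def S_def V_def using RS
    by (auto intro!: diff_in_polys_below simp: V_def C_def)
  have RS0: "R \<noteq> 0 \<or> S \<noteq> 0" using RS(5) by (auto simp: R_def S_def)
  have power_diff: "(u - v) ^ M = u ^ M - v ^ M" for u v :: "'a poly"
    using power_CARD_add[OF CHAR_poly_eq, of "u - v" v a] by (simp add: M_def)
  have star_diff: "star (u - v) = star u - star v" for u v
    by (simp add: star_def power_diff left_diff_distrib sum_subtractf)
  then have Phi0: "f ^ k * star R + smult (of_int s) (star S) = 0"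
    using RS(6) unfolding Phi_def R_def S_def star_diff
    by (simp add: smult_diff_right right_diff_distrib add_diff_eq diff_add_eq eq_diff_eq)

  define G where "G = poly R T + f ^ h * poly S T"
  have coeff_deg: "degree (coeff p i) \<le> M - 1" if "p \<in> V" for p i
    using that C[of "coeff p i"] by (auto simp: V_def polys_below_def)
  have "G \<noteq> 0"
  proof
    assume "G = 0"
    then have "R = 0 \<and> S = 0"
      using coeff_deg RS_V dM M3 Mk \<open>odd L\<close>
      by (intro stepanov_nonvanishing[OF monic nonsquare L_def, of R "M - 1" S])
        (auto simp: G_def h_def T_def d_def)
    then show False using RS0 by blast
  qed

  have eval_poly: "(eval_ac x (poly p T)) ^ M = eval_ac x (star p)"
    if "p \<in> V" and x: "x ^ (M * L) = x" for p x
  proof -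
    have "eval_ac x (poly p T) = (\<Sum>j<J. eval_ac x (coeff p j) * (x ^ L) ^ j)"
      using that by (simp add: poly_eq_sum_polys_below[of p J C] V_def eval_ac_sum T_def)
    then have "(eval_ac x (poly p T)) ^ M = (\<Sum>j<J. (eval_ac x (coeff p j) * (x ^ L) ^ j) ^ M)"
      unfolding M_def by (simp add: power_CARD_sum)
    also have "\<dots> = (\<Sum>j<J. eval_ac x (coeff p j) ^ M * (x ^ (M * L)) ^ j)"
      by (simp add: power_mult_distrib mult_ac flip: power_mult)
    also have "\<dots> = eval_ac x (star p)"
      by (simp add: x star_def eval_ac_sum)
    finally show ?thesis .
  qed

  have "P dvd G" if P: "P \<in> {P \<in> monic_irreducibles n. poly_legendre f P = s}" for P
  proof -
    have irr: "irreducible P" and deg: "degree P = n"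
      using P by (auto simp: monic_irreducibles_def)
    obtain x where x: "eval_ac x P = 0" using irreducible_has_root[OF irr] .
    have fixed: "x ^ (M * L) = x"
      using root_in_frob_fixed_iff[OF irr x, of n] deg by (simp add: Q_eq frob_fixed_def)
    define y where "y = eval_ac x f"
    have "of_int s = y ^ ((M * L - 1) div 2)"
      using of_int_poly_legendre[OF odd irr x, of f] P deg by (simp add: y_def Q_eq)
    also have "(M * L - 1) div 2 = k + h * M" by (simp add: Mk Lh algebra_simps)
    finally have y: "y ^ k * (y ^ h) ^ M = of_int s" by (simp add: power_add power_mult)
    have y0: "y \<noteq> 0"
    proof -
      have "\<not> P dvd f" using P s by (auto simp: poly_legendre_def)
      then show ?thesis using eval_ac_eq_0_iff_dvd[OF irr x] by (simp add: y_def)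
    qed
    have "eval_ac x G ^ M = eval_ac x (poly R T) ^ M + (y ^ h * eval_ac x (poly S T)) ^ M"
      unfolding G_def M_def by (simp add: power_CARD_add y_def)
    also have "\<dots> = eval_ac x (star R) + (y ^ h) ^ M * eval_ac x (star S)"
      by (simp add: power_mult_distrib eval_poly RS_V fixed)
    finally have "y ^ k * eval_ac x G ^ M = y ^ k * eval_ac x (star R) + of_int s * eval_ac x (star S)"
      by (simp add: distrib_left mult.assoc[symmetric] y)
    also have "\<dots> = eval_ac x (f ^ k * star R + smult (of_int s) (star S))"
      by (simp add: y_def)
    also have "\<dots> = 0" by (simp only: Phi0) simp
    finally have "eval_ac x G = 0" using y0 by simp
    then show "P dvd G" using eval_ac_eq_0_iff_dvd[OF irr x] by simp
  qed
  then have "n * card {P \<in> monic_irreducibles n. poly_legendre f P = s} \<le> degree G"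
    using \<open>G \<noteq> 0\<close> by (intro card_monic_irreducible_divisors) auto
  also have "degree G \<le> d * h + ((M - 1) + L * (J - 1))"
  proof -
    have *: "degree (poly p T) \<le> (M - 1) + L * (J - 1)" if "p \<in> V" for p
    proof -
      have "degree (coeff p j * T ^ j) \<le> (M - 1) + L * (J - 1)" if "j < J" for j
      proof -
        have "degree (T ^ j) \<le> L * (J - 1)"
          using that by (auto simp: T_def monom_power degree_monom_eq)
        then show ?thesis
          using coeff_deg[OF \<open>p \<in> V\<close>, of j] by (intro order.trans[OF degree_mult_le] add_mono)
      qed
      then show ?thesis
        using that poly_eq_sum_polys_below[of p J C T] by (auto simp: V_def intro!: degree_sum_le)
    qed
    have "degree (f ^ h * poly S T) \<le> d * h + ((M - 1) + L * (J - 1))"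
      using *[OF RS_V(2)] degree_power_le[of f h]
      by (intro order.trans[OF degree_mult_le] add_mono) (auto simp: d_def)
    then show ?thesis unfolding G_def using *[OF RS_V(1)] by (intro degree_add_le) auto
  qed
  finally have "2 * (n * card {P \<in> monic_irreducibles n. poly_legendre f P = s})
      \<le> 2 * (d * h) + 2 * (M - 1) + 2 * (L * (J - 1))" by simp
  \<comment> \<open>As \<open>2 * k = M - 1\<close>, the leading term is \<open>M * L\<close> less
    one \<open>L\<close>, and that \<open>L\<close> absorbs \<open>2 * (M - 1)\<close>. The terms
    with \<open>d\<close> come to at most \<open>3 * d * L\<close>.\<close>
  also have "\<dots> \<le> M * L + 4 * d * L"
  proof -
    have "2 * (d * h) \<le> d * L" by (simp add: Lh)
    moreover have "2 * (L * (J - 1)) + L = M * L + 2 * d * L"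
      by (simp add: J_def Mk algebra_simps)
    moreover have "2 * (M - 1) \<le> L" using M3 by simp
    ultimately show ?thesis by linarith
  qed
  finally show ?thesis unfolding Q_eq[symmetric] d_def L_def[symmetric] .
qed

text \<open>An upper bound for one sign and the lower bound for the number of all primes give a
  lower bound for the other sign. The 7 is 4 from \<open>stepanov_bound\<close>, 2 from the prime
  count and 1 from primes dividing \<open>f\<close>.\<close>

lemma legendre_sum_bound:
  fixes f :: "'a::{field,finite} poly"
  assumes odd: "odd (CARD('a))"
    and monic: "lead_coeff f = 1" and nonsquare: "\<nexists>g. f = g\<^sup>2"
    and n: "n = a + b" "a < b"
    and d: "0 < degree f" "degree f \<le> CARD('a) ^ a"
  shows "int n * \<bar>\<Sum>P\<in>monic_irreducibles n. poly_legendre f P\<bar> \<le> int (7 * degree f * CARD('a) ^ b)"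
proof -
  define I where "I = (monic_irreducibles n :: 'a poly set)"
  define N where "N = (\<lambda>s. {P \<in> I. poly_legendre f P = s})"
  define L where "L = CARD('a) ^ b"
  have fin: "finite (N s)" for s by (simp add: N_def I_def)
  have I: "I = N 1 \<union> N (-1) \<union> N 0"
    using poly_legendre_range[of f] by (auto simp: N_def)
  have disj: "N 1 \<inter> N (-1) = {}" "(N 1 \<union> N (-1)) \<inter> N 0 = {}"
    by (auto simp: N_def)
  have card_I: "card I = card (N 1) + card (N (-1)) + card (N 0)"
    unfolding I using disj fin by (simp add: card_Un_disjoint)
  have "(\<Sum>P\<in>I. poly_legendre f P) = (\<Sum>P\<in>N 1. poly_legendre f P)
      + (\<Sum>P\<in>N (-1). poly_legendre f P) + (\<Sum>P\<in>N 0. poly_legendre f P)"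
    unfolding I using disj fin by (simp add: sum.union_disjoint)
  also have "\<dots> = int (card (N 1)) - int (card (N (-1)))"
    by (simp add: N_def)
  finally have sum: "(\<Sum>P\<in>I. poly_legendre f P) = int (card (N 1)) - int (card (N (-1)))" .
  have 1: "2 * (n * card (N 1)) \<le> CARD('a) ^ n + 4 * degree f * L"
    "2 * (n * card (N (-1))) \<le> CARD('a) ^ n + 4 * degree f * L"
    unfolding N_def I_def L_def by (intro stepanov_bound[OF assms]; simp)+
  have 0: "n * card (N 0) \<le> degree f"
  proof (rule card_monic_irreducible_divisors)
    show "f \<noteq> 0" using d by auto
  qed (auto simp: N_def I_def poly_legendre_def split: if_splits)
  have "CARD('a) ^ n \<le> n * card I + 2 * CARD('a) ^ (n div 2)"
    unfolding I_def using n by (intro card_monic_irreducibles_ge) auto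
  also have "CARD('a) ^ (n div 2) \<le> L"
    unfolding L_def using n CARD_field_gt_1[where ?'a = 'a] by (intro power_increasing) auto
  finally have "CARD('a) ^ n \<le> n * card (N 1) + n * card (N (-1)) + n * card (N 0) + 2 * L"
    by (simp add: card_I algebra_simps)
  moreover have "degree f \<le> degree f * L" "L \<le> degree f * L"
    using d by (auto simp: L_def Suc_leI)
  ultimately have "n * card (N 1) \<le> n * card (N (-1)) + 7 * degree f * L"
    "n * card (N (-1)) \<le> n * card (N 1) + 7 * degree f * L"
    using 1 0 by linarith+
  then have "int (n * card (N 1)) \<le> int (n * card (N (-1))) + int (7 * degree f * L)"
    "int (n * card (N (-1))) \<le> int (n * card (N 1)) + int (7 * degree f * L)"
    by linarith+
  then have "\<bar>int n * (int (card (N 1)) - int (card (N (-1))))\<bar> \<le> int (7 * degree f * L)"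
    by (simp add: right_diff_distrib abs_le_iff)
  then show ?thesis
    by (simp add: sum[unfolded I_def] L_def abs_mult)
qed

section \<open>Averaging the L-functions\<close>

lemma sum_inverse_power_le:
  fixes q :: real
  assumes "q \<ge> 2" "k \<le> N"
  shows "(\<Sum>d\<in>{k<..N}. 1 / q ^ d) \<le> 1 / q ^ k - 1 / q ^ N"
  using assms(2)
proof (induction N rule: dec_induct)
  case (step N)
  have "2 * (1 / q ^ Suc N) \<le> 1 / q ^ N"
    using assms(1) by (simp add: field_simps)
  moreover have "{k<..Suc N} = insert (Suc N) {k<..N}" using step.hyps by auto
  ultimately show ?case using step.IH by simp
qed auto

text \<open>In degree d there are q^d polynomials of weight q^(-2d), leaving a geometric tail.
  Bounding all finite subsets yields both summability and the value bound in
  \<open>L_fun_truncate\<close>.\<close>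

lemma sum_degree_weight_le:
  fixes F :: "'a::{field,finite} poly set"
  assumes "finite F" "F \<subseteq> {f \<in> monic_polys. k < degree f}"
  shows "(\<Sum>f\<in>F. 1 / real CARD('a) ^ (2 * degree f)) \<le> 1 / real CARD('a) ^ k"
proof -
  define q where "q = real CARD('a)"
  have q: "q \<ge> 2" using CARD_field_gt_1[where ?'a = 'a] unfolding q_def by linarith
  define N where "N = Max (insert k (degree ` F))"
  have N: "k \<le> N" "\<And>f. f \<in> F \<Longrightarrow> degree f \<le> N"
    unfolding N_def using assms(1) by (auto intro: Max_ge)
  define S where "S = (\<Union>d\<in>{k<..N}. {f :: 'a poly. f \<in> monic_polys \<and> degree f = d})"
  have S: "finite S" unfolding S_def using card_monic_polys_degree by blast
  have "(\<Sum>f\<in>F. 1 / q ^ (2 * degree f)) \<le> (\<Sum>f\<in>S. 1 / q ^ (2 * degree f))"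
    using assms N q S by (intro sum_mono2) (auto simp: S_def)
  also have "\<dots> = (\<Sum>d\<in>{k<..N}. \<Sum>f\<in>{f :: 'a poly. f \<in> monic_polys \<and> degree f = d}. 1 / q ^ (2 * degree f))"
    unfolding S_def using card_monic_polys_degree by (intro sum.UNION_disjoint) auto
  also have "\<dots> = (\<Sum>d\<in>{k<..N}. 1 / q ^ d)"
  proof (intro sum.cong refl)
    fix d
    have "(\<Sum>f\<in>{f :: 'a poly. f \<in> monic_polys \<and> degree f = d}. 1 / q ^ (2 * degree f))
      = (\<Sum>f\<in>{f :: 'a poly. f \<in> monic_polys \<and> degree f = d}. 1 / q ^ (2 * d))"
      by (intro sum.cong) auto
    also have "\<dots> = q ^ d * (1 / q ^ (2 * d))"
      using card_monic_polys_degree[of d, where ?'a = 'a] by (simp add: q_def)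
    also have "\<dots> = 1 / q ^ d" using q by (simp add: field_simps flip: power_add)
    finally show "(\<Sum>f\<in>{f :: 'a poly. f \<in> monic_polys \<and> degree f = d}. 1 / q ^ (2 * degree f)) = 1 / q ^ d" .
  qed
  also have "\<dots> \<le> 1 / q ^ k - 1 / q ^ N" using q N by (intro sum_inverse_power_le)
  also have "\<dots> \<le> 1 / q ^ k" using q by simp
  finally show ?thesis by (simp add: q_def)
qed

section \<open>Truncation of the L-series and the sums over each degree\<close>

lemma L_fun_term:
  fixes f :: "'a::{field,finite} poly"
  assumes "f \<in> monic_polys"
  shows "of_int (quad_char D f) * of_real (poly_abs f) powr (- 2) =
    (of_real (of_int (quad_char D f) / real CARD('a) ^ (2 * degree f)) :: complex)"
proof -
  have "f \<noteq> 0" using assms by (auto simp: monic_polys_def)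
  then have "poly_abs f = real CARD('a) ^ degree f" by (simp add: poly_abs_def)
  moreover have "(z :: complex) powr (- 2) = 1 / z ^ 2" if "z \<noteq> 0" for z
    using powr_nat[of z 2] that by (simp add: powr_minus divide_inverse)
  ultimately show ?thesis by (simp add: power_mult[symmetric] mult.commute)
qed

text \<open>The tail is estimated by the trivial bound on the symbol, uniformly in \<open>D\<close>.
  Terms are grouped by degree because the averages over \<open>P\<close> are estimated degree by
  degree.\<close>

lemma L_fun_truncate:
  fixes D :: "'a::{field,finite} poly"
  shows "norm (L_fun 2 D - of_real (\<Sum>d\<le>k. (\<Sum>f\<in>{f. f \<in> monic_polys \<and> degree f = d}.
      of_int (quad_char D f)) / real CARD('a) ^ (2 * d))) \<le> 1 / real CARD('a) ^ k"
proof -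
  define q where "q = real CARD('a)"
  define t where "t = (\<lambda>f :: 'a poly. complex_of_real (of_int (quad_char D f) / q ^ (2 * degree f)))"
  define v where "v = (\<lambda>f :: 'a poly. 1 / q ^ (2 * degree f))"
  define A where "A = {f :: 'a poly. f \<in> monic_polys \<and> k < degree f}"
  define S where "S = (\<Union>d\<in>{..k}. {f :: 'a poly. f \<in> monic_polys \<and> degree f = d})"
  have q: "q > 0" by (simp add: q_def)
  have S: "finite S" unfolding S_def using card_monic_polys_degree by blast
  have split: "monic_polys = S \<union> A" "S \<inter> A = {}"
    by (auto simp: S_def A_def)
  have tv: "norm (t f) \<le> v f" for f
  proof -
    have "\<bar>real_of_int (quad_char D f)\<bar> \<le> 1"
      using abs_quad_char_le_1[of D f] by (metis of_int_1_le_iff of_int_abs of_int_le_1_iff)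
    then show ?thesis using q by (simp add: t_def v_def norm_divide norm_power divide_right_mono)
  qed
  have vle: "sum v F \<le> 1 / q ^ k" if "finite F" "F \<subseteq> A" for F
    using sum_degree_weight_le[of F k] that by (simp add: v_def q_def A_def)
  \<comment> \<open>Without summability \<open>L_fun\<close> would be the default value 0 and could
    not be split.\<close>
  have v: "v summable_on A"
    by (rule nonneg_bdd_above_summable_on)
      (use vle q in \<open>auto simp: v_def intro!: bdd_aboveI2[of _ _ "1 / q ^ k"]\<close>)
  then have abs: "(\<lambda>f. norm (t f)) summable_on A"
    by (rule Infinite_Sum.abs_summable_on_comparison_test') (use tv in auto)
  have "L_fun 2 D = (\<Sum>\<^sub>\<infinity>f\<in>monic_polys. t f)"
    unfolding L_fun_def t_def q_def by (intro infsum_cong) (simp add: L_fun_term)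
  also have "\<dots> = (\<Sum>\<^sub>\<infinity>f\<in>S. t f) + (\<Sum>\<^sub>\<infinity>f\<in>A. t f)"
    unfolding split(1) using S split(2) abs
    by (intro infsum_Un_disjoint) (auto intro: Infinite_Sum.abs_summable_summable)
  also have "(\<Sum>\<^sub>\<infinity>f\<in>S. t f) = (\<Sum>d\<le>k. \<Sum>f\<in>{f. f \<in> monic_polys \<and> degree f = d}. t f)"
    using S card_monic_polys_degree unfolding S_def
    by (simp only: infsum_finite) (intro sum.UNION_disjoint; auto)
  also have "\<dots> = of_real (\<Sum>d\<le>k. (\<Sum>f\<in>{f. f \<in> monic_polys \<and> degree f = d}.
      of_int (quad_char D f)) / q ^ (2 * d))"
    unfolding of_real_sum sum_divide_distrib by (intro sum.cong) (auto simp: t_def)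
  finally have "norm (L_fun 2 D - of_real (\<Sum>d\<le>k. (\<Sum>f\<in>{f. f \<in> monic_polys \<and> degree f = d}.
      of_int (quad_char D f)) / q ^ (2 * d))) = norm (\<Sum>\<^sub>\<infinity>f\<in>A. t f)" by simp
  also have "\<dots> \<le> (\<Sum>\<^sub>\<infinity>f\<in>A. norm (t f))" by (rule norm_infsum_bound) (rule abs)
  also have "\<dots> \<le> (\<Sum>\<^sub>\<infinity>f\<in>A. v f)" by (intro infsum_mono abs v tv)
  also have "\<dots> \<le> 1 / q ^ k" by (rule infsum_le_finite_sums) (use v vle in auto)
  finally show ?thesis by (simp add: q_def)
qed

text \<open>A square root of a monic polynomial has leading coefficient 1 or -1, and in odd
  characteristic exactly one of the two roots is monic.\<close>

lemma card_monic_squares: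
  assumes odd: "odd (CARD('a::{field,finite}))"
  shows "card {f :: 'a poly. f \<in> monic_polys \<and> degree f = d \<and> (\<exists>g. f = g\<^sup>2)} =
    (if even d then CARD('a) ^ (d div 2) else 0)"
proof (cases "even d")
  case True
  define e where "e = d div 2"
  have d: "d = 2 * e" using True by (simp add: e_def)
  define W where "W = {g :: 'a poly. g \<in> monic_polys \<and> degree g = e}"
  have two: "(2 :: 'a) \<noteq> 0" by (rule two_neq_0_of_odd_CARD[OF odd])
  have "{f :: 'a poly. f \<in> monic_polys \<and> degree f = d \<and> (\<exists>g. f = g\<^sup>2)} = (\<lambda>g. g\<^sup>2) ` W"
  proof (intro equalityI subsetI)
    fix f :: "'a poly" assume "f \<in> {f. f \<in> monic_polys \<and> degree f = d \<and> (\<exists>g. f = g\<^sup>2)}"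
    then obtain g where f: "lead_coeff f = 1" "degree f = d" "f = g\<^sup>2"
      by (auto simp: monic_polys_def)
    then have "g \<noteq> 0" by auto
    then have deg: "degree g = e" using f d by (simp add: degree_power_eq)
    have "(lead_coeff g)\<^sup>2 = 1" using f(1) by (simp only: f(3) lead_coeff_power)
    then have "lead_coeff g = 1 \<or> lead_coeff g = - 1" by (simp only: power2_eq_1_iff)
    then have "lead_coeff g = 1 \<or> lead_coeff (- g) = 1" by auto
    then have "g \<in> W \<or> - g \<in> W" using deg by (auto simp: W_def monic_polys_def)
    then show "f \<in> (\<lambda>g. g\<^sup>2) ` W" unfolding f(3) by (metis image_eqI power2_minus)
  next
    fix f assume "f \<in> (\<lambda>g. g\<^sup>2) ` W"
    then obtain g where g: "lead_coeff g = 1" "degree g = e" "f = g\<^sup>2"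
      by (auto simp: W_def monic_polys_def)
    then have "g \<noteq> 0" by auto
    then have "degree f = d" using g d by (simp add: degree_power_eq)
    moreover have "lead_coeff f = 1" unfolding g(3) lead_coeff_power g(1) by simp
    ultimately show "f \<in> {f. f \<in> monic_polys \<and> degree f = d \<and> (\<exists>g. f = g\<^sup>2)}"
      using g by (auto simp: monic_polys_def)
  qed
  moreover have "inj_on (\<lambda>g. g\<^sup>2) W"
  proof (rule inj_onI)
    fix g h assume gh: "g \<in> W" "h \<in> W" "g\<^sup>2 = h\<^sup>2"
    have "g \<noteq> - h"
    proof
      assume "g = - h"
      then have "(1::'a) = - 1" using gh by (auto simp: W_def monic_polys_def)
      then show False using two by (simp add: eq_neg_iff_add_eq_0)
    qed
    then show "g = h" using gh by (simp add: power2_eq_iff)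
  qed
  ultimately show ?thesis
    using True card_monic_polys_degree[of e, where ?'a = 'a] by (simp add: card_image W_def e_def)
next
  case False
  have empty: "{f :: 'a poly. f \<in> monic_polys \<and> degree f = d \<and> (\<exists>g. f = g\<^sup>2)} = {}"
  proof (rule ccontr)
    assume "{f :: 'a poly. f \<in> monic_polys \<and> degree f = d \<and> (\<exists>g. f = g\<^sup>2)} \<noteq> {}"
    then obtain g :: "'a poly" where "degree (g\<^sup>2) = d" by auto
    then have "d = 2 * degree g" by (cases "g = 0") (auto simp: degree_power_eq)
    then show False using False by simp
  qed
  show ?thesis unfolding empty using False by simp
qed

text \<open>A square contributes exactly 1 for every prime, its root having degree below
  \<open>n\<close>; each of the at most q^d nonsquares is bounded by
  \<open>legendre_sum_bound\<close>.\<close>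

lemma quad_char_double_sum:
  fixes \<gamma> :: "'a::{field,finite}"
  assumes odd: "odd (CARD('a))" and \<gamma>: "\<gamma> \<noteq> 0" and n: "n = a + b" "a < b" and d: "d \<le> a"
  shows "\<bar>(\<Sum>f\<in>{f. f \<in> monic_polys \<and> degree f = d}.
      \<Sum>P\<in>monic_irreducibles n. real_of_int (quad_char (smult \<gamma> P) f))
    - (if even d then real CARD('a) ^ (d div 2) else 0) * real (card (monic_irreducibles n :: 'a poly set))\<bar>
    \<le> real CARD('a) ^ d * (7 * real CARD('a) ^ b)"
proof -
  define I where "I = (monic_irreducibles n :: 'a poly set)"
  define q where "q = CARD('a)"
  define W where "W = {f :: 'a poly. f \<in> monic_polys \<and> degree f = d}"
  define Y where "Y = {f \<in> W. \<exists>g. f = g\<^sup>2}"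
  have W: "finite W" "card W = q ^ d"
    unfolding W_def q_def using card_monic_polys_degree by blast+
  have Y: "Y \<subseteq> W" "card Y = (if even d then q ^ (d div 2) else 0)"
    using card_monic_squares[OF odd, of d] by (auto simp: Y_def W_def q_def conj_assoc)
  obtain \<tau> :: int where \<tau>: "\<tau> \<in> {1, -1}"
    "\<And>P f. P \<in> I \<Longrightarrow> f \<in> monic_polys \<Longrightarrow> quad_char (smult \<gamma> P) f = \<tau> ^ degree f * poly_legendre f P"
    unfolding I_def using quad_char_smult[OF odd \<gamma>] by blast
  define s where "s = (\<lambda>f. \<Sum>P\<in>I. real_of_int (quad_char (smult \<gamma> P) f))"
  have sY: "s f = real (card I)" if f: "f \<in> Y" for f
  proof -
    obtain g where g: "f = g\<^sup>2" "degree f = d" "f \<in> monic_polys" using f by (auto simp: W_def Y_def)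
    then have "f \<noteq> 0" by (auto simp: monic_polys_def)
    then have g0: "g \<noteq> 0" "d = 2 * degree g" using g by (auto simp: degree_power_eq)
    have "quad_char (smult \<gamma> P) f = 1" if P: "P \<in> I" for P
    proof -
      have "irreducible P" "degree g < degree P"
        using P g0 n d by (auto simp: I_def monic_irreducibles_def)
      then have "poly_legendre f P = 1" using poly_legendre_square g0 g(1) by blast
      moreover have "\<tau> ^ degree f = 1" using \<tau>(1) g(2) g0(2) by (auto simp: power_mult)
      ultimately show ?thesis using \<tau>(2)[OF P g(3)] by simp
    qed
    then show ?thesis by (simp add: s_def)
  qed
  have sX: "\<bar>s f\<bar> \<le> 7 * real q ^ b" if f: "f \<in> W - Y" for f
  proof -
    have f': "f \<in> monic_polys" "lead_coeff f = 1" "degree f = d" "\<nexists>g. f = g\<^sup>2"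
      using f by (auto simp: W_def Y_def monic_polys_def)
    \<comment> \<open>The only monic constant is 1, which is a square.\<close>
    have "d > 0"
    proof (rule ccontr)
      assume "\<not> d > 0"
      then obtain c where "f = [:c:]" using f'(3) by (auto elim: degree_eq_zeroE)
      then have "f = 1\<^sup>2" using f'(2) by (simp add: one_pCons power2_eq_square)
      then show False using f'(4) by blast
    qed
    \<comment> \<open>Ensures the restriction \<open>degree f \<le> CARD('a) ^ a\<close> of the
      Stepanov bound.\<close>
    have "a < q ^ a" unfolding q_def by (rule power_gt_expt) (use CARD_field_gt_1 in auto)
    then have bound: "int n * \<bar>\<Sum>P\<in>I. poly_legendre f P\<bar> \<le> int (7 * d * q ^ b)"
      using legendre_sum_bound[OF odd f'(2,4) n] f'(3) \<open>d > 0\<close> d by (simp add: I_def q_def)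
    \<comment> \<open>Since \<open>d \<le> n\<close>, the division by \<open>n\<close> cancels the
      factor \<open>degree f\<close> of the bound.\<close>
    have "int d * \<bar>\<Sum>P\<in>I. poly_legendre f P\<bar> \<le> int n * \<bar>\<Sum>P\<in>I. poly_legendre f P\<bar>"
      using d n by (intro mult_right_mono) auto
    also note bound
    finally have "\<bar>\<Sum>P\<in>I. poly_legendre f P\<bar> \<le> 7 * int q ^ b"
      using \<open>d > 0\<close> by simp
    moreover have "s f = real_of_int (\<tau> ^ d * (\<Sum>P\<in>I. poly_legendre f P))"
      unfolding s_def of_int_sum sum_distrib_left by (intro sum.cong) (auto simp: \<tau>(2) f')
    moreover have "\<bar>\<tau> ^ d\<bar> = 1" using \<tau>(1) by (auto simp: power_abs)
    ultimately have "\<bar>s f\<bar> \<le> real_of_int (7 * int q ^ b)"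
      by (simp only: of_int_abs[symmetric] of_int_le_iff abs_mult)
    then show ?thesis by simp
  qed
  have "(\<Sum>f\<in>W. s f) = (\<Sum>f\<in>W - Y. s f) + (\<Sum>f\<in>Y. s f)"
    using W Y by (intro sum.subset_diff) auto
  also have "(\<Sum>f\<in>Y. s f) = (if even d then real q ^ (d div 2) else 0) * real (card I)"
    using Y by (simp add: sY)
  finally have "\<bar>(\<Sum>f\<in>W. s f) - (if even d then real q ^ (d div 2) else 0) * real (card I)\<bar>
      = \<bar>\<Sum>f\<in>W - Y. s f\<bar>" by simp
  also have "\<dots> \<le> (\<Sum>f\<in>W - Y. \<bar>s f\<bar>)" by (rule sum_abs)
  also have "\<dots> \<le> (\<Sum>f\<in>W - Y. 7 * real q ^ b)" by (intro sum_mono sX)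
  also have "\<dots> \<le> (\<Sum>f\<in>W. 7 * real q ^ b)" using W by (intro sum_mono2) auto
  also have "\<dots> = real q ^ d * (7 * real q ^ b)" using W by simp
  finally show ?thesis unfolding W_def s_def I_def q_def .
qed

text \<open>For d = 2e the term is q^e / q^(4e) = q^(-3e), so the limit is the geometric series of
  zeta_A(4). The tail starts at exponent \<open>3 * Suc m\<close>, which exceeds \<open>a\<close>;
  the factor 2 is a bound for \<open>1 / (1 - c)\<close>.\<close>

lemma sum_inverse_cubes:
  fixes q :: real
  assumes "q \<ge> 2"
  shows "\<bar>(\<Sum>d\<le>a. (if even d then q ^ (d div 2) else 0) / q ^ (2 * d)) - 1 / (1 - 1 / q ^ 3)\<bar> \<le> 2 / q ^ a"
proof -
  define c where "c = 1 / q ^ 3"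
  define m where "m = a div 2"
  have "2 ^ 3 \<le> q ^ 3" using assms by (intro power_mono) auto
  then have c: "0 < c" "c \<le> 1 / 2" using assms by (auto simp: c_def field_simps)
  have "(\<Sum>d\<le>a. (if even d then q ^ (d div 2) else 0) / q ^ (2 * d))
      = (\<Sum>d\<in>{d\<in>{..a}. even d}. q ^ (d div 2) / q ^ (2 * d))"
    by (subst sum.inter_filter) (auto intro!: sum.cong)
  also have "\<dots> = (\<Sum>e\<le>m. c ^ e)"
  proof (rule sum.reindex_bij_witness[of _ "\<lambda>e. 2 * e" "\<lambda>d. d div 2"])
    fix d assume d: "d \<in> {d \<in> {..a}. even d}"
    then obtain e where e: "d = 2 * e" by auto
    have "q ^ (2 * d) = q ^ e * (q ^ 3) ^ e"
      by (simp add: e flip: power_mult power_add)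
    then show "c ^ (d div 2) = q ^ (d div 2) / q ^ (2 * d)"
      using assms by (simp add: e c_def power_one_over)
  qed (auto simp: m_def)
  also have "\<dots> = (1 - c ^ Suc m) / (1 - c)"
    using c sum_gp_strict[of c "Suc m"] unfolding lessThan_Suc_atMost by simp
  finally have "\<bar>(\<Sum>d\<le>a. (if even d then q ^ (d div 2) else 0) / q ^ (2 * d)) - 1 / (1 - c)\<bar>
      = c ^ Suc m / (1 - c)"
    using c by (simp add: diff_divide_distrib)
  also have "\<dots> \<le> c ^ Suc m / (1 / 2)"
    using c by (intro divide_left_mono) auto
  also have "c ^ Suc m = 1 / q ^ (3 * Suc m)"
    by (simp only: c_def power_one_over power_mult)
  also have "\<dots> \<le> 1 / q ^ a"
    using assms by (intro divide_left_mono power_increasing) (auto simp: m_def)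
  finally show ?thesis by (simp add: c_def)
qed

text \<open>The 21 adds up four errors in units of q^b: 1 for truncation at degree \<open>a\<close>,
  14 for the nonsquares, 2 for the missing tail of squares, and 4 for replacing the number of primes
  by q^n / n.\<close>

lemma sum_L_fun_bound:
  fixes \<gamma> :: "'a::{field,finite}"
  assumes odd: "odd (CARD('a))" and \<gamma>: "\<gamma> \<noteq> 0" and n: "n = a + b" "a < b"
  shows "norm ((\<Sum>P\<in>(monic_irreducibles n :: 'a poly set). L_fun 2 (smult \<gamma> P))
      - of_real (1 / (1 - 1 / real CARD('a) ^ 3) * (real CARD('a) ^ n / real n))) \<le> 21 * real CARD('a) ^ b"
proof -
  define I where "I = (monic_irreducibles n :: 'a poly set)"
  define q where "q = real CARD('a)"
  have q: "q \<ge> 2" using CARD_field_gt_1[where ?'a = 'a] unfolding q_def by linarith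
  define W where "W = (\<lambda>d. {f :: 'a poly. f \<in> monic_polys \<and> degree f = d})"
  define Z where "Z = (\<lambda>d. \<Sum>f\<in>W d. \<Sum>P\<in>I. real_of_int (quad_char (smult \<gamma> P) f))"
  define E where "E = (\<lambda>d. if even d then q ^ (d div 2) else 0)"
  define \<pi> where "\<pi> = real (card I)"
  define \<zeta> where "\<zeta> = 1 / (1 - 1 / q ^ 3)"
  have npos: "n > 0" using n by simp
  have qn: "q ^ n = q ^ a * q ^ b" by (simp add: n power_add)
  have q1: "1 \<le> q ^ m" for m using q by simp

  have "real (n * card I) \<le> real (CARD('a) ^ n)"
    unfolding I_def using card_monic_irreducibles_le[OF npos] by (rule of_nat_mono)
  then have n\<pi>: "real n * \<pi> \<le> q ^ n" by (simp add: \<pi>_def q_def)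
  have "1 * \<pi> \<le> real n * \<pi>" using npos by (intro mult_right_mono) (auto simp: \<pi>_def)
  with n\<pi> have \<pi>: "0 \<le> \<pi>" "\<pi> \<le> q ^ n" by (auto simp: \<pi>_def)
  have "real (CARD('a) ^ n) \<le> real (n * card I + 2 * CARD('a) ^ (n div 2))"
    unfolding I_def using card_monic_irreducibles_ge[OF npos] by (rule of_nat_mono)
  then have "q ^ n \<le> real n * \<pi> + 2 * q ^ (n div 2)" by (simp add: \<pi>_def q_def)
  also have "q ^ (n div 2) \<le> q ^ b" using q n by (intro power_increasing) auto
  finally have ge: "q ^ n \<le> real n * \<pi> + 2 * q ^ b" by simp
  have "\<bar>\<pi> - q ^ n / n\<bar> = \<bar>real n * \<pi> - q ^ n\<bar> / n"
    using npos by (simp add: field_simps)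
  also have "\<dots> \<le> 2 * q ^ b / n" using ge n\<pi> by (intro divide_right_mono) auto
  also have "\<dots> \<le> 2 * q ^ b" using npos q1[of b] by (simp add: divide_le_eq)
  finally have pnt: "\<bar>\<pi> - q ^ n / n\<bar> \<le> 2 * q ^ b" .

  have "q ^ 3 \<ge> 2 ^ 3" using q by (intro power_mono) auto
  then have "1 - 1 / q ^ 3 \<ge> 1 / 2" using q by (simp add: field_simps)
  then have \<zeta>: "0 < \<zeta>" "\<zeta> \<le> 2"
    unfolding \<zeta>_def using divide_left_mono[of "1 / 2" "1 - 1 / q ^ 3" 1] by simp_all

  have trunc: "norm ((\<Sum>P\<in>I. L_fun 2 (smult \<gamma> P)) - of_real (\<Sum>d\<le>a. Z d / q ^ (2 * d))) \<le> q ^ b"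
  proof -
    have "(\<Sum>d\<le>a. Z d / q ^ (2 * d)) = (\<Sum>P\<in>I. \<Sum>d\<le>a.
        (\<Sum>f\<in>W d. of_int (quad_char (smult \<gamma> P) f)) / q ^ (2 * d))"
    proof -
      have "Z d = (\<Sum>P\<in>I. \<Sum>f\<in>W d. real_of_int (quad_char (smult \<gamma> P) f))" for d
        unfolding Z_def by (rule sum.swap)
      then show ?thesis
        by (subst sum.swap) (simp add: sum_divide_distrib)
    qed
    then have "norm ((\<Sum>P\<in>I. L_fun 2 (smult \<gamma> P)) - of_real (\<Sum>d\<le>a. Z d / q ^ (2 * d)))
      = norm (\<Sum>P\<in>I. L_fun 2 (smult \<gamma> P) - of_real (\<Sum>d\<le>a.
        (\<Sum>f\<in>W d. of_int (quad_char (smult \<gamma> P) f)) / q ^ (2 * d)))"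
      by (simp only: of_real_sum sum_subtractf)
    also have "\<dots> \<le> (\<Sum>P\<in>I. 1 / q ^ a)"
      unfolding W_def q_def by (intro sum_norm_le L_fun_truncate)
    also have "\<dots> = \<pi> / q ^ a" by (simp add: \<pi>_def)
    also have "\<dots> \<le> q ^ n / q ^ a" using \<pi> q by (intro divide_right_mono) auto
    also have "\<dots> = q ^ b" using q by (simp add: qn)
    finally show ?thesis .
  qed

  have "\<bar>(\<Sum>d\<le>a. Z d / q ^ (2 * d)) - \<pi> * (\<Sum>d\<le>a. E d / q ^ (2 * d))\<bar> = \<bar>\<Sum>d\<le>a. (Z d - E d * \<pi>) / q ^ (2 * d)\<bar>"
    by (simp add: sum_distrib_left sum_subtractf diff_divide_distrib mult.commute)
  also have "\<dots> \<le> (\<Sum>d\<le>a. \<bar>(Z d - E d * \<pi>) / q ^ (2 * d)\<bar>)" by (rule sum_abs)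
  also have "\<dots> \<le> (\<Sum>d\<le>a. 7 * q ^ b * (1 / q ^ d))"
  proof (intro sum_mono)
    fix d assume "d \<in> {..a}"
    then have "\<bar>Z d - E d * \<pi>\<bar> \<le> q ^ d * (7 * q ^ b)"
      unfolding Z_def E_def \<pi>_def W_def I_def q_def
      by (intro quad_char_double_sum[OF odd \<gamma> n]) simp
    then have "\<bar>Z d - E d * \<pi>\<bar> / q ^ (2 * d) \<le> q ^ d * (7 * q ^ b) / q ^ (2 * d)"
      using q by (intro divide_right_mono) auto
    also have "\<dots> = 7 * q ^ b * (1 / q ^ d)" using q by (simp add: mult_2 power_add)
    finally show "\<bar>(Z d - E d * \<pi>) / q ^ (2 * d)\<bar> \<le> 7 * q ^ b * (1 / q ^ d)"
      using q by (simp add: abs_divide)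
  qed
  also have "\<dots> = 7 * q ^ b * (\<Sum>d\<le>a. 1 / q ^ d)" by (simp add: sum_distrib_left)
  also have "(\<Sum>d\<le>a. 1 / q ^ d) \<le> 2"
  proof -
    have "{..a} = insert 0 {0<..a}" by auto
    then have "(\<Sum>d\<le>a. 1 / q ^ d) = 1 + (\<Sum>d\<in>{0<..a}. 1 / q ^ d)" by simp
    also have "\<dots> \<le> 1 + (1 / q ^ 0 - 1 / q ^ a)"
      using q by (intro add_left_mono sum_inverse_power_le) auto
    also have "\<dots> \<le> 2" using q by simp
    finally show ?thesis .
  qed
  finally have nonsq: "\<bar>(\<Sum>d\<le>a. Z d / q ^ (2 * d)) - \<pi> * (\<Sum>d\<le>a. E d / q ^ (2 * d))\<bar> \<le> 14 * q ^ b"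
    using q1[of b] by simp

  have "\<bar>\<pi> * (\<Sum>d\<le>a. E d / q ^ (2 * d)) - \<pi> * \<zeta>\<bar> = \<pi> * \<bar>(\<Sum>d\<le>a. E d / q ^ (2 * d)) - \<zeta>\<bar>"
    using \<pi> by (simp add: abs_mult flip: right_diff_distrib)
  also have "\<dots> \<le> q ^ n * (2 / q ^ a)"
    using \<pi> q unfolding E_def \<zeta>_def by (intro mult_mono sum_inverse_cubes) auto
  also have "\<dots> = 2 * q ^ b" using q by (simp add: qn)
  finally have sq: "\<bar>\<pi> * (\<Sum>d\<le>a. E d / q ^ (2 * d)) - \<pi> * \<zeta>\<bar> \<le> 2 * q ^ b" .

  have "\<pi> * \<zeta> - \<zeta> * (q ^ n / n) = \<zeta> * (\<pi> - q ^ n / n)"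
    by (simp add: right_diff_distrib)
  then have "\<bar>\<pi> * \<zeta> - \<zeta> * (q ^ n / n)\<bar> = \<zeta> * \<bar>\<pi> - q ^ n / n\<bar>"
    using \<zeta> by (simp add: abs_mult)
  also have "\<dots> \<le> 2 * (2 * q ^ b)" using \<zeta> pnt by (intro mult_mono) auto
  finally have "\<bar>(\<Sum>d\<le>a. Z d / q ^ (2 * d)) - \<zeta> * (q ^ n / n)\<bar> \<le> 20 * q ^ b"
    using nonsq sq by linarith
  then have "norm (of_real (\<Sum>d\<le>a. Z d / q ^ (2 * d)) - of_real (\<zeta> * (q ^ n / n)) :: complex) \<le> 20 * q ^ b"
    by (simp only: of_real_diff[symmetric] norm_of_real)
  from norm_diff_triangle_le[OF trunc this] show ?thesis
    unfolding I_def \<zeta>_def q_def[symmetric] by simp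
qed

lemma sum_L_fun_asymptotic:
  fixes \<gamma> :: "'a::{field,finite}" and N :: "nat \<Rightarrow> nat"
  assumes odd: "odd (CARD('a))" and \<gamma>: "\<gamma> \<noteq> 0" and N: "\<And>g. N g > 0" and \<epsilon>: "\<epsilon> > 0"
    and q: "q = CARD('a)"
  shows "(\<lambda>g. (\<Sum>P\<in>(monic_irreducibles (N g) :: 'a poly set). L_fun 2 (smult \<gamma> P))
      - zeta_A q 4 * of_real (real q ^ N g / log (real q) (real q ^ N g)))
    \<in> O(\<lambda>g. of_real ((real q ^ N g) powr (1 / 2 + \<epsilon>)))"
proof (rule bigoI[where c = "21 * real q"], rule always_eventually, rule allI)
  fix g
  have q1: "real q > 1" using CARD_field_gt_1[where ?'a = 'a] q by simp
  define n where "n = N g"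
  \<comment> \<open>The largest \<open>a\<close> with \<open>a < n - a\<close>; then
    \<open>b\<close> exceeds n / 2 by at most 1, and the extra factor q goes into the implied
    constant.\<close>
  define a b where "a = (n - 1) div 2" and "b = n - a"
  have ab: "n = a + b" "a < b" "2 * b \<le> n + 2" using N[of g] by (auto simp: a_def b_def n_def)
  have zeta: "zeta_A q 4 = of_real (1 / (1 - 1 / real q ^ 3))"
  proof -
    have "(of_nat q :: complex) powr (1 - 4) = 1 / of_nat q ^ 3"
      using powr_nat[of "of_nat q :: complex" 3] q1 by (simp add: powr_minus divide_inverse)
    then show ?thesis by (simp add: zeta_A_def)
  qed
  have log: "log (real q) (real q ^ n) = real n"
    using q1 by (simp add: log_nat_power)
  have "norm ((\<Sum>P\<in>(monic_irreducibles n :: 'a poly set). L_fun 2 (smult \<gamma> P))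
      - zeta_A q 4 * of_real (real q ^ n / log (real q) (real q ^ n))) \<le> 21 * real q ^ b"
    unfolding zeta log of_real_mult[symmetric] unfolding q by (rule sum_L_fun_bound[OF odd \<gamma> ab(1,2)])
  also have "real q ^ b = real q powr real b" using q1 by (simp add: powr_realpow)
  also have "\<dots> \<le> real q powr (1 + real n * (1 / 2 + \<epsilon>))"
  proof (rule powr_mono)
    have "real (2 * b) \<le> real (n + 2)" using ab(3) by (rule of_nat_mono)
    moreover have "0 \<le> real n * \<epsilon>" using \<epsilon> by simp
    ultimately show "real b \<le> 1 + real n * (1 / 2 + \<epsilon>)" by (simp add: algebra_simps)
  qed (use q1 in simp)
  also have "\<dots> = real q * (real q ^ n) powr (1 / 2 + \<epsilon>)"
    using q1 by (simp add: powr_add[of _ 1] powr_powr flip: powr_realpow)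
  finally show "norm ((\<Sum>P\<in>(monic_irreducibles (N g) :: 'a poly set). L_fun 2 (smult \<gamma> P))
      - zeta_A q 4 * of_real (real q ^ N g / log (real q) (real q ^ N g)))
    \<le> 21 * real q * norm (of_real ((real q ^ N g) powr (1 / 2 + \<epsilon>)) :: complex)"
    by (simp add: n_def)
qed

theorem theorem2p11:
  fixes \<gamma> :: "'a::{field,finite}" and p k q :: nat and \<epsilon> :: real
  assumes "prime p" and "odd p" and "q = p ^ k" and "CARD('a) = q"
    and "generates_units \<gamma>"
    and "\<epsilon> > 0"
  shows
    "((\<lambda>g::nat. (\<Sum>P\<in>(monic_irreducibles (2 * g + 1) :: 'a poly set). L_fun 2 P)
        - zeta_A q 4 * of_real (real q ^ (2 * g + 1) / log (real q) (real q ^ (2 * g + 1))))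
      \<in> O(\<lambda>g. of_real ((real q ^ (2 * g + 1)) powr (1 / 2 + \<epsilon>))))
    \<and>
    ((\<lambda>g::nat. (\<Sum>P\<in>(monic_irreducibles (2 * g + 2) :: 'a poly set). L_fun 2 P)
        - zeta_A q 4 * of_real (real q ^ (2 * g + 2) / log (real q) (real q ^ (2 * g + 2))))
      \<in> O(\<lambda>g. of_real ((real q ^ (2 * g + 2)) powr (1 / 2 + \<epsilon>))))
    \<and>
    ((\<lambda>g::nat. (\<Sum>P\<in>(monic_irreducibles (2 * g + 2) :: 'a poly set). L_fun 2 (smult \<gamma> P))
        - zeta_A q 4 * of_real (real q ^ (2 * g + 2) / log (real q) (real q ^ (2 * g + 2))))
      \<in> O(\<lambda>g. of_real ((real q ^ (2 * g + 2)) powr (1 / 2 + \<epsilon>))))"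
proof -
  have odd: "odd (CARD('a))" using assms(2-4) by simp
  have "\<gamma> \<noteq> 0" using assms(5) by (simp add: generates_units_def)
  note * = sum_L_fun_asymptotic[OF odd _ _ assms(6) assms(4)[symmetric]]
  \<comment> \<open>The first two families are the case of the constant 1.\<close>
  show ?thesis
    using *[of 1 "\<lambda>g. 2 * g + 1"] *[of 1 "\<lambda>g. 2 * g + 2"] *[OF \<open>\<gamma> \<noteq> 0\<close>, of "\<lambda>g. 2 * g + 2"]
    by simp
qed

end
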